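(* Let $K_n$ be a complete graph with $n$ vertices. Under both the segment-crossing criterion and the segment-intersection criterion, the geometric pseudo-Grundy index of $K_n$ satisfies $$\left\lfloor \frac{n^2}{400}\right\rfloor \le \gamma'_g(K_n).$$
   Context: A geometric graph of a graph $G$ is a drawing of $G$ in the plane in which the vertices are points in general position (no three collinear) and every edge is the straight-line segment joining its endpoints. Two distinct edges cross if they meet at a point interior to both segments; they intersect if they share an endpoint or cross. Segment-crossing criterion: two distinct edges are adjacent if and only if they cross. Segment-intersection criterion: two distinct edges are adjacent if and only if they intersect. For a fixed adjacency criterion, a pseudo-Grundy $k$-coloring of a geometric graph $\mathsf{G}$ is an assignment of the colors $1,\dots,k$ to all the edges (not necessarily proper), with every color used, such that for every pair of colors $i<j$, every edge of color $j$ is adjacent to at least one edge of color $i$. The pseudo-Grundy index $\gamma'(\mathsf{G})$ is the largest $k$ for which $\mathsf{G}$ has a pseudo-Grundy $k$-coloring. The geometric pseudo-Grundy index of a graph $G$ is $\gamma'_g(G)=\min\{\gamma'(\mathsf{G}) : \mathsf{G}\text{ is a geometric graph of } G\}$. *)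

theory Defs
  imports "HOL-Analysis.Analysis" "HOL-Library.Ramsey"
begin

text \<open>A simple graph is a pair of a vertex set and a set of 2-element subsets of it.\<close>

type_synonym 'a graph = "'a set \<times> 'a set set"

abbreviation verts :: "'a graph \<Rightarrow> 'a set" where "verts \<equiv> fst"
abbreviation edges :: "'a graph \<Rightarrow> 'a set set" where "edges \<equiv> snd"

definition complete_graph :: "'a set \<Rightarrow> 'a graph" where
  "complete_graph V = (V, [V]\<^bsup>2\<^esup>)"

text \<open>A geometric graph of \<open>G\<close> is given by the placement \<open>p\<close> of the vertices of \<open>G\<close> in the plane;
  the edge \<open>{u, v}\<close> is drawn as the segment from \<open>p u\<close> to \<open>p v\<close>.\<close>

definition geometric_graph :: "'a graph \<Rightarrow> ('a \<Rightarrow> real^2) \<Rightarrow> bool" where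
  "geometric_graph G p \<longleftrightarrow> inj_on p (verts G) \<and>
     (\<forall>u\<in>verts G. \<forall>v\<in>verts G. \<forall>w\<in>verts G.
        u \<noteq> v \<and> u \<noteq> w \<and> v \<noteq> w \<longrightarrow> \<not> collinear {p u, p v, p w})"

text \<open>An adjacency criterion depends on the placement and on two edges.\<close>

type_synonym 'a criterion = "('a \<Rightarrow> real^2) \<Rightarrow> 'a set \<Rightarrow> 'a set \<Rightarrow> bool"

definition segment_crossing :: "'a criterion" where
  "segment_crossing p e f \<longleftrightarrow> e \<noteq> f \<and>
     (\<exists>u v x y. e = {u, v} \<and> f = {x, y} \<and>
        open_segment (p u) (p v) \<inter> open_segment (p x) (p y) \<noteq> {})"

definition segment_intersection :: "'a criterion" where
  "segment_intersection p e f \<longleftrightarrow> e \<noteq> f \<and> (e \<inter> f \<noteq> {} \<or> segment_crossing p e f)"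

definition pseudo_Grundy_coloring ::
    "'a criterion \<Rightarrow> 'a graph \<Rightarrow> ('a \<Rightarrow> real^2) \<Rightarrow> nat \<Rightarrow> ('a set \<Rightarrow> nat) \<Rightarrow> bool" where
  "pseudo_Grundy_coloring adj G p k c \<longleftrightarrow> c ` edges G = {1..k} \<and>
     (\<forall>i\<in>{1..k}. \<forall>j\<in>{1..k}. i < j \<longrightarrow>
        (\<forall>e\<in>edges G. c e = j \<longrightarrow> (\<exists>f\<in>edges G. c f = i \<and> adj p e f)))"

definition pseudo_Grundy_index :: "'a criterion \<Rightarrow> 'a graph \<Rightarrow> ('a \<Rightarrow> real^2) \<Rightarrow> nat" where
  "pseudo_Grundy_index adj G p = Max {k. \<exists>c. pseudo_Grundy_coloring adj G p k c}"

text \<open>The set below is a set of natural numbers, so its infimum is attained when it is nonempty.\<close>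

definition geometric_pseudo_Grundy_index :: "'a criterion \<Rightarrow> 'a graph \<Rightarrow> nat" where
  "geometric_pseudo_Grundy_index adj G =
     Inf {pseudo_Grundy_index adj G p |p. geometric_graph G p}"

text \<open>For finite graphs the maximum and the minimum above range over nonempty sets, the former
  finite.\<close>

lemma finite_pseudo_Grundy_coloring_sizes:
  assumes "finite (edges G)"
  shows "finite {k. \<exists>c. pseudo_Grundy_coloring adj G p k c}"
proof (rule finite_subset)
  show "{k. \<exists>c. pseudo_Grundy_coloring adj G p k c} \<subseteq> {..card (edges G)}"
  proof clarify
    fix k c assume "pseudo_Grundy_coloring adj G p k c"
    then have "c ` edges G = {1..k}" by (simp add: pseudo_Grundy_coloring_def)
    with card_image_le[OF assms, of c] show "k \<le> card (edges G)" by simp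
  qed
qed simp

lemma ex_pseudo_Grundy_coloring: "\<exists>k c. pseudo_Grundy_coloring adj G p k c"
proof (cases "edges G = {}")
  case True
  then have "pseudo_Grundy_coloring adj G p 0 c" for c
    by (simp add: pseudo_Grundy_coloring_def)
  then show ?thesis by blast
next
  case False
  then have "pseudo_Grundy_coloring adj G p 1 (\<lambda>_. 1)"
    by (auto simp: pseudo_Grundy_coloring_def)
  then show ?thesis by blast
qed

lemma ex_geometric_graph:
  assumes "finite (verts G)"
  shows "\<exists>p. geometric_graph G p"
proof -
  obtain g :: "'a \<Rightarrow> nat" where g: "inj_on g (verts G)"
    using finite_imp_inj_to_nat_seg[OF assms] by blast
  define q :: "nat \<Rightarrow> real^2" where "q n = vector [real n, real n ^ 2]" for n
  have q: "q n $ 1 = real n" "q n $ 2 = real n ^ 2" for n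
    by (simp_all add: q_def)
  have parabola: "\<not> collinear {q a, q b, q c}" if "a \<noteq> b" "a \<noteq> c" "b \<noteq> c" for a b c
  proof
    assume "collinear {q a, q b, q c}"
    then obtain u where u: "\<And>x y. x \<in> {q a, q b, q c} \<Longrightarrow> y \<in> {q a, q b, q c} \<Longrightarrow> \<exists>r. x - y = r *\<^sub>R u"
      unfolding collinear_def by blast
    obtain r s where r: "q b - q a = r *\<^sub>R u" and s: "q c - q a = s *\<^sub>R u"
      using u[of "q b" "q a"] u[of "q c" "q a"] by auto
    have 1: "real b - real a = r * u $ 1" "real b ^ 2 - real a ^ 2 = r * u $ 2"
      using arg_cong[OF r, of "\<lambda>v. v $ 1"] arg_cong[OF r, of "\<lambda>v. v $ 2"] by (simp_all add: q)
    have 2: "real c - real a = s * u $ 1" "real c ^ 2 - real a ^ 2 = s * u $ 2"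
      using arg_cong[OF s, of "\<lambda>v. v $ 1"] arg_cong[OF s, of "\<lambda>v. v $ 2"] by (simp_all add: q)
    have "(real b - real a) * (real c ^ 2 - real a ^ 2) = (real c - real a) * (real b ^ 2 - real a ^ 2)"
      unfolding 1 2 by simp
    then have "(real b - real a) * (real c - real a) * (real c - real b) = 0"
      by algebra
    with that show False by simp
  qed
  have "inj q"
    by (metis injI of_nat_eq_iff q(1))
  then have "geometric_graph G (q \<circ> g)"
    unfolding geometric_graph_def using g parabola
    by (simp add: comp_inj_on inj_on_subset inj_on_eq_iff)
  then show ?thesis by blast
qed

end

theory Submission
  imports Defs
begin

text \<open>Let \<open>A\<close>, \<open>B\<close>, \<open>C\<close>, \<open>D\<close> be sets of vertices such that every segment from \<open>A\<close> to \<open>C\<close> crosses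
every segment from \<open>B\<close> to \<open>D\<close>, with at least \<open>k\<close> segments of either kind; this is a
\<open>crossing_family\<close> of size \<open>k\<close>.  It gives a pseudo-Grundy coloring with \<open>k\<close> colors: the color \<open>i\<close>
goes to one segment of each kind, so that every edge of a color \<open>j \<noteq> i\<close> among these crosses an
edge of color \<open>i\<close>, and all other edges get color 1, from which nothing is required.  The theorem
thus follows once every set of \<open>n\<close> points in general position with \<open>n\<^sup>2 \<ge> 400 k\<close> has a crossing
family of size \<open>k\<close>.  It is enough to have \<open>n \<ge> 8 a + 10 b - 8\<close> for some \<open>a\<close>, \<open>b\<close> with
\<open>k \<le> a b\<close> and \<open>k \<le> b\<^sup>2\<close> (\<open>ex_arm_sizes\<close>).

Fix a direction to be called horizontal.  Let \<open>L\<close> and \<open>R\<close> consist of the \<open>q = 4 a + b - 2\<close> leftmost and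
rightmost points and let \<open>M\<close> be the rest.  Choose a lower and an upper line, each with a prescribed
number of points of \<open>L\<close>, and the same number of points of \<open>R\<close>, below it.  If \<open>b\<close> points of \<open>M\<close> lie
above the upper line and \<open>b\<close> points below the lower one, then these two sets, together with the points of
\<open>L\<close> and of \<open>R\<close> between the lines, form a crossing family of size \<open>b\<^sup>2\<close>.  Otherwise \<open>M\<close> is, up to fewer
than \<open>b\<close> points, below the upper line (\<open>M\<close> is low) or above the lower line (\<open>M\<close> is high); this is
\<open>crossing_family_or_low_middle\<close>.

Now turn the direction by \<open>\<pi>\<close>.  This exchanges low and high, so that there are arbitrarily close
directions, possibly equal ones, such that \<open>M\<close> is low for one and high for the other.  Between close
directions each of \<open>L\<close> and \<open>R\<close> changes by at most one point, because no three points are collinear.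
Hence there are two lines with a set \<open>W\<close> of \<open>6 b - 4\<close> points of \<open>M\<close> between them, and
four arms of \<open>2 a - 1\<close> points each: on the left and on the right of \<open>W\<close>, points on or above the line
over \<open>W\<close> and points on or below the line under \<open>W\<close> (\<open>low_and_high_middle_crossing_family\<close>).

Finally, four such arms around \<open>W\<close> yield a crossing family of size \<open>a b\<close>
(\<open>arms_crossing_family\<close>).  Draw through a point of each arm a line that cuts off the same number of
points of \<open>W\<close> and leaves \<open>a\<close> points of the arm on the side that matters.  If the lines of two
neighboring arms divide \<open>W\<close> crosswise, with \<open>b\<close> points in each of two opposite parts, then these parts and the
two arms contain a family of convex quadrilaterals, whose diagonals cross.  If this fails for the
two upper arms, for the two lower arms and for the two right arms, then counting gives points \<open>v\<close> and \<open>w\<close> of \<open>W\<close>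
that lie on opposite sides of all four lines with signs that alternate around \<open>W\<close>.  The two lines on the left
then put \<open>w\<close> to the left of \<open>v\<close>, and the two lines on the right put \<open>v\<close> to the left of \<open>w\<close>.\<close>

section \<open>Non-vertical lines and crossing segments\<close>

definition graph_line :: "(real \<Rightarrow> real) \<Rightarrow> bool" where
  "graph_line f \<longleftrightarrow> (\<exists>s c. f = (\<lambda>t. s * t + c))"

definition chord :: "('a \<Rightarrow> real) \<Rightarrow> ('a \<Rightarrow> real) \<Rightarrow> 'a \<Rightarrow> 'a \<Rightarrow> real \<Rightarrow> real" where
  "chord x y a c = (\<lambda>t. y a + (y c - y a) / (x c - x a) * (t - x a))"

text \<open>Vertices are given by two coordinate functions, since the argument passes between many coordinate
systems.  Writing the common point by its ratios on the two segments makes it evident that crossing is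
preserved by affine changes of coordinates.\<close>

definition crosses :: "('a \<Rightarrow> real) \<Rightarrow> ('a \<Rightarrow> real) \<Rightarrow> 'a \<Rightarrow> 'a \<Rightarrow> 'a \<Rightarrow> 'a \<Rightarrow> bool" where
  "crosses x y a c b d \<longleftrightarrow> (\<exists>\<alpha> \<beta>. 0 < \<alpha> \<and> \<alpha> < 1 \<and> 0 < \<beta> \<and> \<beta> < 1 \<and>
     (1 - \<alpha>) * x a + \<alpha> * x c = (1 - \<beta>) * x b + \<beta> * x d \<and>
     (1 - \<alpha>) * y a + \<alpha> * y c = (1 - \<beta>) * y b + \<beta> * y d)"

definition general_position :: "('a \<Rightarrow> real) \<Rightarrow> ('a \<Rightarrow> real) \<Rightarrow> 'a set \<Rightarrow> bool" where
  "general_position x y V \<longleftrightarrow> (\<forall>u\<in>V. \<forall>v\<in>V. \<forall>w\<in>V. u \<noteq> v \<and> u \<noteq> w \<and> v \<noteq> w \<longrightarrow>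
     (x v - x u) * (y w - y u) \<noteq> (x w - x u) * (y v - y u))"

definition crossing_family :: "('a \<Rightarrow> real) \<Rightarrow> ('a \<Rightarrow> real) \<Rightarrow> 'a set \<Rightarrow> nat \<Rightarrow> bool" where
  "crossing_family x y V k \<longleftrightarrow> (\<exists>A B C D. A \<union> B \<union> C \<union> D \<subseteq> V \<and>
     (A \<union> C) \<inter> (B \<union> D) = {} \<and> A \<inter> C = {} \<and> B \<inter> D = {} \<and>
     k \<le> card A * card C \<and> k \<le> card B * card D \<and>
     (\<forall>a\<in>A. \<forall>c\<in>C. \<forall>b\<in>B. \<forall>d\<in>D. crosses x y a c b d))"

text \<open>The form of affinity on which all comparisons of lines rest: it has no division, so its signs can
be read off from the order of the three arguments.\<close>

lemma graph_line_weighted: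
  assumes "graph_line f"
  shows "(t3 - t1) * f t2 = (t3 - t2) * f t1 + (t2 - t1) * f t3"
  using assms by (auto simp: graph_line_def algebra_simps)

lemma graph_line_diff: "graph_line f \<Longrightarrow> graph_line g \<Longrightarrow> graph_line (\<lambda>t. f t - g t)"
  unfolding graph_line_def
proof safe
  fix s c s' c' :: real
  show "\<exists>s'' c''. (\<lambda>t. s * t + c - (s' * t + c')) = (\<lambda>t. s'' * t + c'')"
    by (rule exI[of _ "s - s'"], rule exI[of _ "c - c'"]) (auto simp: algebra_simps)
qed

lemma graph_line_less_between:
  assumes f: "graph_line f" and g: "graph_line g" and t: "t1 < t2" "t2 < t3"
    and le: "f t1 \<le> g t1" "f t3 \<le> g t3" and strict: "f t1 < g t1 \<or> f t3 < g t3"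
  shows "f t2 < g t2"
proof -
  have e: "(t3 - t1) * (g t2 - f t2) = (t3 - t2) * (g t1 - f t1) + (t2 - t1) * (g t3 - f t3)"
    using graph_line_weighted[OF graph_line_diff[OF g f], of t3 t1 t2] .
  have "0 < (t3 - t2) * (g t1 - f t1) + (t2 - t1) * (g t3 - f t3)"
    using strict
  proof
    assume "f t1 < g t1"
    then show ?thesis using t le by (intro add_pos_nonneg mult_pos_pos mult_nonneg_nonneg) auto
  next
    assume "f t3 < g t3"
    then show ?thesis using t le by (intro add_nonneg_pos mult_pos_pos mult_nonneg_nonneg) auto
  qed
  with e have "0 < (t3 - t1) * (g t2 - f t2)" by simp
  then show ?thesis using t by (simp add: zero_less_mult_iff)
qed

lemma graph_line_le_between:
  assumes f: "graph_line f" and g: "graph_line g" and t: "t1 \<le> t2" "t2 \<le> t3"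
    and le: "f t1 \<le> g t1" "f t3 \<le> g t3"
  shows "f t2 \<le> g t2"
proof (cases "t1 = t2 \<or> t2 = t3")
  case False
  then have t: "t1 < t2" "t2 < t3" using t by auto
  have e: "(t3 - t1) * (g t2 - f t2) = (t3 - t2) * (g t1 - f t1) + (t2 - t1) * (g t3 - f t3)"
    using graph_line_weighted[OF graph_line_diff[OF g f], of t3 t1 t2] .
  have "0 \<le> (t3 - t2) * (g t1 - f t1) + (t2 - t1) * (g t3 - f t3)"
    using t le by (intro add_nonneg_nonneg mult_nonneg_nonneg) auto
  with e have "0 \<le> (t3 - t1) * (g t2 - f t2)" by simp
  then show ?thesis using t by (simp add: zero_le_mult_iff)
qed (use le in auto)

lemma graph_line_eqI:
  assumes f: "graph_line f" and g: "graph_line g" and "t1 \<noteq> t2" "f t1 = g t1" "f t2 = g t2"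
  shows "f t = g t"
proof -
  have "(t2 - t1) * (f t - g t) = 0"
    using graph_line_weighted[OF graph_line_diff[OF f g], of t2 t1 t] assms by simp
  then show ?thesis using assms by simp
qed

lemma graph_line_chord: "graph_line (chord x y a c)"
proof -
  have "chord x y a c = (\<lambda>t. m * t + (y a - m * x a))" if "m = (y c - y a) / (x c - x a)" for m
    unfolding chord_def that[symmetric] by (simp add: algebra_simps)
  then show ?thesis unfolding graph_line_def by blast
qed

lemma chord_left [simp]: "chord x y a c (x a) = y a"
  by (simp add: chord_def)

lemma chord_right [simp]: "x a \<noteq> x c \<Longrightarrow> chord x y a c (x c) = y c"
  by (simp add: chord_def)

lemma chord_param:
  assumes "x a \<noteq> x c" shows "chord x y a c ((1 - \<alpha>) * x a + \<alpha> * x c) = (1 - \<alpha>) * y a + \<alpha> * y c"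
proof -
  have "(1 - \<alpha>) * x a + \<alpha> * x c - x a = \<alpha> * (x c - x a)" by (simp add: algebra_simps)
  then have "chord x y a c ((1 - \<alpha>) * x a + \<alpha> * x c) = y a + \<alpha> * (y c - y a)"
    using assms by (simp add: chord_def)
  then show ?thesis by (simp add: algebra_simps)
qed

lemma graph_line_reflect: "graph_line f \<Longrightarrow> graph_line (\<lambda>t. f (- t))"
  unfolding graph_line_def by (metis mult_minus_right mult_minus_left)

lemma graph_line_uminus: "graph_line f \<Longrightarrow> graph_line (\<lambda>t. - f t)"
proof -
  assume "graph_line f"
  then obtain s c where "f = (\<lambda>t. s * t + c)" by (auto simp: graph_line_def)
  then have "(\<lambda>t. - f t) = (\<lambda>t. (- s) * t + (- c))" by (simp add: fun_eq_iff)
  then show ?thesis unfolding graph_line_def by blast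
qed

lemma crossesI_at:
  assumes ac: "x a < x c" and bd: "x b < x d" and t: "x a < t" "t < x c" "x b < t" "t < x d"
    and eq: "chord x y a c t = chord x y b d t"
  shows "crosses x y a c b d"
proof -
  define \<alpha> \<beta> where "\<alpha> = (t - x a) / (x c - x a)" and "\<beta> = (t - x b) / (x d - x b)"
  have "(1 - \<alpha>) * x a + \<alpha> * x c = x a + \<alpha> * (x c - x a)" by (simp add: algebra_simps)
  also have "\<dots> = t" using ac by (simp add: \<alpha>_def)
  finally have 1: "(1 - \<alpha>) * x a + \<alpha> * x c = t" .
  have "(1 - \<beta>) * x b + \<beta> * x d = x b + \<beta> * (x d - x b)" by (simp add: algebra_simps)
  also have "\<dots> = t" using bd by (simp add: \<beta>_def)
  finally have 2: "(1 - \<beta>) * x b + \<beta> * x d = t" .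
  have "0 < \<alpha>" "\<alpha> < 1" "0 < \<beta>" "\<beta> < 1" using t ac bd by (auto simp: \<alpha>_def \<beta>_def)
  moreover have "(1 - \<alpha>) * y a + \<alpha> * y c = (1 - \<beta>) * y b + \<beta> * y d"
    using chord_param[of x a c y \<alpha>] chord_param[of x b d y \<beta>] 1 2 eq ac bd by simp
  ultimately show ?thesis unfolding crosses_def using 1 2 by metis
qed

lemma graph_line_zero:
  assumes f: "graph_line f" and t: "t1 < t2" and s: "f t1 < 0 \<and> 0 < f t2 \<or> 0 < f t1 \<and> f t2 < 0"
  obtains t where "t1 < t" "t < t2" "f t = (0::real)"
proof -
  define t where "t = t1 + (t2 - t1) * (f t1 / (f t1 - f t2))"
  have r: "0 < f t1 / (f t1 - f t2)" "f t1 / (f t1 - f t2) < 1"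
    using s by (auto simp: divide_simps)
  have "t1 < t" using mult_pos_pos[OF _ r(1), of "t2 - t1"] t by (simp add: t_def)
  moreover have "t < t2"
    using r t mult_strict_left_mono[OF r(2), of "t2 - t1"] by (simp add: t_def)
  moreover have "f t = 0"
  proof -
    have "(t2 - t1) * f t = (t2 - t) * f t1 + (t - t1) * f t2"
      by (rule graph_line_weighted[OF f])
    also have "\<dots> = (t2 - t1) * f t1 - (t - t1) * (f t1 - f t2)" by (simp add: algebra_simps)
    also have "(t - t1) * (f t1 - f t2) = (t2 - t1) * f t1"
      using s by (auto simp: t_def)
    finally show ?thesis using t by simp
  qed
  ultimately show thesis using that by blast
qed

text \<open>Two segments over a common interval that change their vertical order there must meet strictly inside it.\<close>

lemma crosses_if_chords_change_order:
  assumes ac: "x a < x c" and bd: "x b < x d"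
    and t: "x a \<le> t" "t \<le> x c" "x b \<le> t" "t \<le> x d" "x a \<le> t'" "t' \<le> x c" "x b \<le> t'" "t' \<le> x d"
    and s: "chord x y a c t < chord x y b d t" "chord x y b d t' < chord x y a c t'"
  shows "crosses x y a c b d"
proof -
  define f where "f = (\<lambda>t. chord x y a c t - chord x y b d t)"
  have f: "graph_line f" unfolding f_def by (intro graph_line_diff graph_line_chord)
  have ft: "f t < 0" "0 < f t'" using s by (auto simp: f_def)
  then have "t \<noteq> t'" by auto
  then consider "t < t'" | "t' < t" by linarith
  then obtain z where z: "min t t' < z" "z < max t t'" "f z = 0"
  proof cases
    case 1 then show ?thesis using graph_line_zero[OF f 1] ft that by (metis max.absorb4 min.absorb3)
  next
    case 2 then show ?thesis using graph_line_zero[OF f 2] ft that by (metis max.absorb3 min.absorb4)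
  qed
  show ?thesis
    by (rule crossesI_at[where t = z and x = x and y = y]) (use z t ac bd in \<open>auto simp: f_def\<close>)
qed

lemma crosses_opposite_sides:
  assumes lr: "x l < x u" "x u < x r" "x l < x d" "x d < x r"
    and s: "chord x y l r (x u) < y u" "y d < chord x y l r (x d)"
  shows "crosses x y l r u d"
proof -
  define f where "f = chord x y l r"
  define g where "g = (\<lambda>\<beta>. (1 - \<beta>) * y u + \<beta> * y d - f ((1 - \<beta>) * x u + \<beta> * x d))"
  have fl: "graph_line f" by (simp add: f_def graph_line_chord)
  then obtain s c where fe: "f = (\<lambda>t. s * t + c)" by (auto simp: graph_line_def)
  have "graph_line (\<lambda>\<beta>. - g \<beta>)" unfolding graph_line_def g_def fe
    by (rule exI[of _ "y u - y d + s * (x d - x u)"], rule exI[of _ "s * x u + c - y u"])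
       (auto simp: algebra_simps)
  moreover have "- g 0 < 0" "0 < - g 1" using s by (auto simp: g_def f_def)
  ultimately obtain \<beta> where b: "0 < \<beta>" "\<beta> < 1" "g \<beta> = 0"
    using graph_line_zero[of "\<lambda>\<beta>. - g \<beta>" 0 1] by auto
  define t where "t = (1 - \<beta>) * x u + \<beta> * x d"
  have "(1 - \<beta>) * x l + \<beta> * x l < t" "t < (1 - \<beta>) * x r + \<beta> * x r"
    unfolding t_def using lr b by (intro add_strict_mono mult_strict_left_mono; simp)+
  then have t: "x l < t" "t < x r" by (auto simp: algebra_simps)
  define \<alpha> where "\<alpha> = (t - x l) / (x r - x l)"
  have a: "0 < \<alpha>" "\<alpha> < 1" using t by (auto simp: \<alpha>_def)
  have "(1 - \<alpha>) * x l + \<alpha> * x r = x l + \<alpha> * (x r - x l)" by (simp add: algebra_simps)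
  also have "\<dots> = t" using t by (simp add: \<alpha>_def)
  finally have 1: "(1 - \<alpha>) * x l + \<alpha> * x r = t" .
  have "(1 - \<alpha>) * y l + \<alpha> * y r = f t"
    using chord_param[of x l r y \<alpha>] 1 t by (simp add: f_def)
  also have "\<dots> = (1 - \<beta>) * y u + \<beta> * y d" using b(3) by (simp add: g_def t_def)
  finally show ?thesis unfolding crosses_def using a b 1 t_def by metis
qed

lemma crosses_reflect_y: "crosses x (\<lambda>v. - y v) a c b d \<longleftrightarrow> crosses x y a c b d"
proof -
  have *: "(p * - r + q * - s = p' * - r' + q' * - s') = (p * r + q * s = p' * r' + q' * s')"
    for p q r s p' q' r' s' :: real by (auto simp: algebra_simps)
  show ?thesis unfolding crosses_def * by simp
qed

lemma crosses_reflect_x: "crosses (\<lambda>v. - x v) y a c b d \<longleftrightarrow> crosses x y a c b d"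
proof -
  have *: "(p * - r + q * - s = p' * - r' + q' * - s') = (p * r + q * s = p' * r' + q' * s')"
    for p q r s p' q' r' s' :: real by (auto simp: algebra_simps)
  show ?thesis unfolding crosses_def * by simp
qed

lemma crossing_family_reflect:
  "crossing_family (\<lambda>v. - x v) y V k \<longleftrightarrow> crossing_family x y V k"
  "crossing_family x (\<lambda>v. - y v) V k \<longleftrightarrow> crossing_family x y V k"
  by (simp_all add: crossing_family_def crosses_reflect_x crosses_reflect_y)

lemma general_position_reflect:
  "general_position (\<lambda>v. - x v) y V \<longleftrightarrow> general_position x y V"
proof -
  have *: "((- x v - - x u) * (y w - y u) = (- x w - - x u) * (y v - y u)) \<longleftrightarrow>
      ((x v - x u) * (y w - y u) = (x w - x u) * (y v - y u))" for u v w
    by (auto simp: algebra_simps)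
  show ?thesis unfolding general_position_def by (simp only: *)
qed

section \<open>Lines with a prescribed number of points below\<close>

lemma ex_rank:
  fixes f :: "'a \<Rightarrow> 'b::linorder"
  assumes "finite A" "inj_on f A" "i < card A"
  shows "\<exists>a\<in>A. card {b\<in>A. f b < f a} = i"
  using assms
proof (induction "card A" arbitrary: A)
  case (Suc n)
  then have ne: "A \<noteq> {}" by auto
  define m where "m = arg_max_on f A"
  have m: "m \<in> A" "\<And>b. b \<in> A \<Longrightarrow> f b \<le> f m"
  proof -
    have "\<exists>m\<in>A. \<forall>b\<in>A. f b \<le> f m"
      using Max_in[of "f ` A"] Max_ge[of "f ` A"] Suc.prems(1) ne
      by (metis (no_types, lifting) finite_imageI image_iff image_is_empty)
    then obtain m' where "m' \<in> A" "\<forall>b\<in>A. f b \<le> f m'" by blast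
    then have "is_arg_max f (\<lambda>a. a \<in> A) m'" by (auto simp: is_arg_max_linorder)
    then have "is_arg_max f (\<lambda>a. a \<in> A) m"
      unfolding m_def arg_max_on_def arg_max_def by (rule someI)
    then show "m \<in> A" "\<And>b. b \<in> A \<Longrightarrow> f b \<le> f m" by (auto simp: is_arg_max_linorder)
  qed
  have lt: "f b < f m" if "b \<in> A - {m}" for b
    using m that Suc.prems(2) by (metis DiffE insertI1 inj_on_eq_iff le_less)
  show ?case
  proof (cases "i = n")
    case True
    have "{b \<in> A. f b < f m} = A - {m}" using lt by auto
    then show ?thesis using True Suc m by (intro bexI[of _ m]) auto
  next
    case False
    have "\<exists>a\<in>A - {m}. card {b\<in>A - {m}. f b < f a} = i"
      using Suc m False by (intro Suc.hyps(1)) (auto intro: inj_on_subset)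
    then obtain a where a: "a \<in> A - {m}" "card {b\<in>A - {m}. f b < f a} = i" by blast
    have "{b\<in>A. f b < f a} = {b\<in>A - {m}. f b < f a}" using lt[OF a(1)] by auto
    then show ?thesis using a by (intro bexI[of _ a]) auto
  qed
qed simp

lemma general_positionD:
  assumes "general_position x y V" "u \<in> V" "v \<in> V" "w \<in> V" "u \<noteq> v" "u \<noteq> w" "v \<noteq> w"
  shows "(x v - x u) * (y w - y u) \<noteq> (x w - x u) * (y v - y u)"
  using assms unfolding general_position_def by blast

lemma general_position_subset:
  "general_position x y V \<Longrightarrow> U \<subseteq> V \<Longrightarrow> general_position x y U"
  unfolding general_position_def by blast

lemma general_position_not_on_line:
  assumes gp: "general_position x y V" and V: "u \<in> V" "v \<in> V" "w \<in> V" and d: "u \<noteq> v" "u \<noteq> w" "v \<noteq> w"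
    and f: "graph_line f" "f (x u) = y u" "f (x v) = y v"
  shows "f (x w) \<noteq> y w"
proof
  assume w: "f (x w) = y w"
  obtain s c where s: "f = (\<lambda>t. s * t + c)" using f by (auto simp: graph_line_def)
  have "y v - y u = s * (x v - x u)" "y w - y u = s * (x w - x u)"
    using f(2,3) w unfolding s by (auto simp: algebra_simps)
  then show False using general_positionD[OF gp V d] by simp
qed

text \<open>In the arrangement of points \<open>W\<close>, such a line belongs to the \<open>p\<close>-th level: it touches \<open>W\<close> and has exactly
\<open>p\<close> points of \<open>W\<close> strictly below it.\<close>

definition level_line :: "('a \<Rightarrow> real) \<Rightarrow> ('a \<Rightarrow> real) \<Rightarrow> 'a set \<Rightarrow> nat \<Rightarrow> (real \<Rightarrow> real) \<Rightarrow> bool" where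
  "level_line x y W p f \<longleftrightarrow>
     graph_line f \<and> (\<exists>w\<in>W. f (x w) = y w) \<and> card {w\<in>W. y w < f (x w)} = p"

text \<open>A line of the same level cannot lie strictly above another one all over \<open>W\<close>: the point of \<open>W\<close> on the
lower line would be counted in addition.\<close>

lemma level_lines_meet:
  assumes W: "finite W" and f: "level_line x y W p f" and g: "level_line x y W p g"
  shows "\<exists>w\<in>W. g (x w) \<le> f (x w)"
proof (rule ccontr)
  assume "\<not> (\<exists>w\<in>W. g (x w) \<le> f (x w))"
  then have less: "\<And>w. w \<in> W \<Longrightarrow> f (x w) < g (x w)" by force
  obtain w where w: "w \<in> W" "f (x w) = y w" using f by (auto simp: level_line_def)
  have "insert w {w\<in>W. y w < f (x w)} \<subseteq> {w\<in>W. y w < g (x w)}" using less w by force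
  then have "card (insert w {w\<in>W. y w < f (x w)}) \<le> card {w\<in>W. y w < g (x w)}"
    using W by (intro card_mono) auto
  then show False using f g w W by (simp add: level_line_def)
qed

text \<open>Two lines of the same level meet over the range of \<open>W\<close>, and distinct lines meet only once, so their order does
not change to the left of \<open>W\<close>.\<close>

lemma level_lines_less_left:
  assumes W: "finite W" and f: "level_line x y W p f" and g: "level_line x y W p g"
    and t: "\<And>w. w \<in> W \<Longrightarrow> t0 < x w" "\<And>w. w \<in> W \<Longrightarrow> t < x w" and less: "f t0 < g t0"
  shows "f t < g t"
proof (rule ccontr)
  assume "\<not> f t < g t"
  then have ge: "g t \<le> f t" by simp
  have fl: "graph_line f" and gl: "graph_line g" using f g by (auto simp: level_line_def)
  obtain w where w: "w \<in> W" "g (x w) \<le> f (x w)" using level_lines_meet[OF W f g] by blast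
  obtain w' where w': "w' \<in> W" "f (x w') \<le> g (x w')" using level_lines_meet[OF W g f] by blast
  consider "t < t0" | "t0 < t" | "t = t0" by linarith
  then show False
  proof cases
    case 1
    then have "g t0 \<le> f t0"
      using graph_line_le_between[OF gl fl, of t t0 "x w"] ge w t(1)[OF w(1)] by auto
    then show False using less by simp
  next
    case 2
    then have "f t < g t"
      using graph_line_less_between[OF fl gl, of t0 t "x w'"] less w' t(2)[OF w'(1)] by auto
    then show False using ge by simp
  qed (use less ge in auto)
qed

lemma level_lines_eq_left:
  assumes W: "finite W" and f: "level_line x y W p f" and g: "level_line x y W p g"
    and t: "\<And>w. w \<in> W \<Longrightarrow> t0 < x w" and eq: "f t0 = g t0"
  shows "f t = g t"
proof -
  have fl: "graph_line f" and gl: "graph_line g" using f g by (auto simp: level_line_def)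
  obtain w where w: "w \<in> W" "g (x w) \<le> f (x w)" using level_lines_meet[OF W f g] by blast
  obtain w' where w': "w' \<in> W" "f (x w') \<le> g (x w')" using level_lines_meet[OF W g f] by blast
  have "\<exists>w\<in>W. f (x w) = g (x w)"
  proof (cases "x w \<le> x w'")
    case True
    then have "f (x w) \<le> g (x w)"
      using graph_line_le_between[OF fl gl, of t0 "x w" "x w'"] eq w' t[OF w(1)] by auto
    then show ?thesis using w by force
  next
    case False
    then have "g (x w') \<le> f (x w')"
      using graph_line_le_between[OF gl fl, of t0 "x w'" "x w"] eq w t[OF w'(1)] by auto
    then show ?thesis using w' by force
  qed
  then show ?thesis using graph_line_eqI[OF fl gl _ eq] t by (metis less_irrefl)
qed

text \<open>Sort the points of \<open>W\<close> by the slope at which they are seen from \<open>l\<close>; general position makes the slopes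
distinct, and the line through \<open>l\<close> and the point of rank \<open>p\<close> is the desired one.\<close>

lemma ex_level_line_through:
  assumes W: "finite W" and gp: "general_position x y (insert l W)"
    and lW: "\<And>w. w \<in> W \<Longrightarrow> x l < x w" and p: "p < card W"
  shows "\<exists>f. level_line x y W p f \<and> f (x l) = y l"
proof -
  define m where "m w = (y w - y l) / (x w - x l)" for w
  have "inj_on m W"
  proof (rule inj_onI, rule ccontr)
    fix v w assume vw: "v \<in> W" "w \<in> W" "m v = m w" "v \<noteq> w"
    have "(x v - x l) * (y w - y l) \<noteq> (x w - x l) * (y v - y l)"
      using vw lW by (intro general_positionD[OF gp]) auto
    moreover have "x v - x l \<noteq> 0" "x w - x l \<noteq> 0" using lW vw by force+
    ultimately show False using vw(3) by (simp add: m_def frac_eq_eq algebra_simps)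
  qed
  then obtain w where w: "w \<in> W" "card {v\<in>W. m v < m w} = p"
    using ex_rank[OF W _ p] by blast
  define f where "f = chord x y l w"
  have "y v < f (x v) \<longleftrightarrow> m v < m w" if v: "v \<in> W" for v
  proof -
    have "0 < x v - x l" using lW v by simp
    moreover have "f (x v) = y l + m w * (x v - x l)" by (simp add: f_def chord_def m_def)
    ultimately show ?thesis by (simp add: m_def pos_divide_less_eq less_diff_eq algebra_simps)
  qed
  then have "{v\<in>W. y v < f (x v)} = {v\<in>W. m v < m w}" by blast
  moreover have "f (x w) = y w" using lW[OF w(1)] by (simp add: f_def)
  ultimately have "level_line x y W p f"
    using w by (auto simp: level_line_def f_def graph_line_chord)
  then show ?thesis by (intro exI[of _ f]) (simp add: f_def)
qed

text \<open>Through each point of \<open>L\<close> there is a line of level \<open>p\<close>, and these lines do not cross to the left of \<open>W\<close>.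
Therefore a point of \<open>L\<close> is below the line of another one exactly if the heights of their lines at the
position \<open>t0\<close> between \<open>L\<close> and \<open>W\<close> are ordered in this way.  The heights thus turn counting in \<open>L\<close> into ranking.\<close>

lemma ex_level_line_pencil:
  assumes W: "finite W" and gp: "general_position x y (L \<union> W)" and p: "p < card W"
    and L: "\<And>l. l \<in> L \<Longrightarrow> x l \<le> t0" and t0: "\<And>w. w \<in> W \<Longrightarrow> t0 < x w"
  shows "\<exists>f. (\<forall>l\<in>L. level_line x y W p (f l) \<and> f l (x l) = y l) \<and>
    inj_on (\<lambda>l. f l t0) L \<and>
    (\<forall>l\<in>L. \<forall>l'\<in>L. y l' < f l (x l') \<longleftrightarrow> f l' t0 < f l t0)"
proof -
  have lw: "x l < x w" if "l \<in> L" "w \<in> W" for l w using L t0 that by force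
  have "\<exists>f. level_line x y W p f \<and> f (x l) = y l" if "l \<in> L" for l
    using lw[OF that] that by (intro ex_level_line_through[OF W _ _ p] general_position_subset[OF gp]) auto
  then obtain f where f: "\<And>l. l \<in> L \<Longrightarrow> level_line x y W p (f l)" "\<And>l. l \<in> L \<Longrightarrow> f l (x l) = y l"
    by metis
  have inj: "inj_on (\<lambda>l. f l t0) L"
  proof (rule inj_onI, rule ccontr)
    fix l l' assume l: "l \<in> L" "l' \<in> L" "f l t0 = f l' t0" "l \<noteq> l'"
    have "f l t = f l' t" for t
      by (rule level_lines_eq_left[OF W f(1)[OF l(1)] f(1)[OF l(2)] t0 l(3)])
    then have "f l (x l') = y l'" using f(2)[OF l(2)] by simp
    moreover obtain w where "w \<in> W" "f l (x w) = y w" "graph_line (f l)"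
      using f(1)[OF l(1)] by (auto simp: level_line_def)
    ultimately show False
      using general_position_not_on_line[OF gp, of l l' w "f l"] l f(2)[OF l(1)] lw by force
  qed
  have "y l' < f l (x l') \<longleftrightarrow> f l' t0 < f l t0" if l: "l \<in> L" "l' \<in> L" for l l'
  proof
    assume "y l' < f l (x l')"
    then have "f l' (x l') < f l (x l')" using f l by simp
    then show "f l' t0 < f l t0"
      using level_lines_less_left[OF W f(1)[OF l(2)] f(1)[OF l(1)], of "x l'" t0] lw l t0 by simp
  next
    assume "f l' t0 < f l t0"
    then have "f l' (x l') < f l (x l')"
      using level_lines_less_left[OF W f(1)[OF l(2)] f(1)[OF l(1)], of t0 "x l'"] lw l t0 by simp
    then show "y l' < f l (x l')" using f l by simp
  qed
  then show ?thesis using f inj by blast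
qed

text \<open>A discrete form of the ham sandwich theorem for two sets that are separated by a vertical line: both
levels can be prescribed.\<close>

lemma ex_line_with_levels:
  assumes fin: "finite L" "finite W" and gp: "general_position x y (L \<union> W)"
    and lw: "\<And>l w. l \<in> L \<Longrightarrow> w \<in> W \<Longrightarrow> x l < x w" and i: "i < card L" and p: "p < card W"
  shows "\<exists>f l w. l \<in> L \<and> w \<in> W \<and> graph_line f \<and> f (x l) = y l \<and> f (x w) = y w \<and>
    card {l\<in>L. y l < f (x l)} = i \<and> card {w\<in>W. y w < f (x w)} = p"
proof -
  define t0 where "t0 = Max (x ` L)"
  have ne: "L \<noteq> {}" using i by auto
  have L: "x l \<le> t0" if "l \<in> L" for l using that fin by (simp add: t0_def)
  have "t0 \<in> x ` L" unfolding t0_def using ne fin by (intro Max_in) auto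
  then have t0: "t0 < x w" if "w \<in> W" for w using lw that by auto
  obtain f where f: "\<And>l. l \<in> L \<Longrightarrow> level_line x y W p (f l)" "\<And>l. l \<in> L \<Longrightarrow> f l (x l) = y l"
    "inj_on (\<lambda>l. f l t0) L" "\<And>l l'. l \<in> L \<Longrightarrow> l' \<in> L \<Longrightarrow> y l' < f l (x l') \<longleftrightarrow> f l' t0 < f l t0"
    using ex_level_line_pencil[OF fin(2) gp p L t0] by metis
  obtain l where l: "l \<in> L" "card {l'\<in>L. f l' t0 < f l t0} = i"
    using ex_rank[OF fin(1) f(3) i] by blast
  have "{l'\<in>L. y l' < f l (x l')} = {l'\<in>L. f l' t0 < f l t0}" using f(4) l by blast
  then have 1: "card {l'\<in>L. y l' < f l (x l')} = i" using l by simp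
  obtain w where "w \<in> W" "f l (x w) = y w" "graph_line (f l)" "card {w\<in>W. y w < f l (x w)} = p"
    using f(1)[OF l(1)] by (auto simp: level_line_def)
  with 1 l f(2)[OF l(1)] show ?thesis by (intro exI[of _ "f l"] exI[of _ l] exI[of _ w]) simp
qed

section \<open>Two neighboring arms\<close>

lemma crossing_familyI:
  assumes "A \<union> B \<union> C \<union> D \<subseteq> V" "(A \<union> C) \<inter> (B \<union> D) = {}" "A \<inter> C = {}" "B \<inter> D = {}"
    and "p \<le> card A" "q \<le> card C" "r \<le> card B" "s \<le> card D" "k \<le> p * q" "k \<le> r * s"
    and "\<And>a b c d. a \<in> A \<Longrightarrow> b \<in> B \<Longrightarrow> c \<in> C \<Longrightarrow> d \<in> D \<Longrightarrow> crosses x y a c b d"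
  shows "crossing_family x y V k"
proof -
  have "k \<le> card A * card C" using mult_le_mono[OF assms(5,6)] assms(9) by (rule le_trans[rotated])
  moreover have "k \<le> card B * card D" using mult_le_mono[OF assms(7,8)] assms(10) by (rule le_trans[rotated])
  ultimately show ?thesis unfolding crossing_family_def
    by (intro exI[of _ A] exI[of _ B] exI[of _ C] exI[of _ D] conjI ballI assms(1-4) assms(11))
qed

text \<open>The line \<open>f\<close> certifies that \<open>v\<close> is below the segment from \<open>u\<close> to \<open>w\<close>, and \<open>g\<close> that \<open>w\<close> is below the segment from \<open>v\<close>
to \<open>z\<close>.  So the two segments change their order between \<open>v\<close> and \<open>w\<close>.\<close>

lemma crosses_facing_pair:
  assumes o: "x u < x v" "x v < x w" "x w < x z"
    and k: "graph_line f" "graph_line g"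
    and f: "f (x u) \<le> y u" "y v \<le> f (x v)" "f (x w) \<le> y w" "y v < f (x v) \<or> f (x w) < y w"
    and g: "g (x z) \<le> y z" "y w \<le> g (x w)" "g (x v) \<le> y v" "y w < g (x w) \<or> g (x v) < y v"
  shows "crosses x y v z u w"
proof (rule crosses_if_chords_change_order[where t = "x v" and t' = "x w" and x = x and y = y])
  have "f (x v) \<le> chord x y u w (x v)"
    by (rule graph_line_le_between[OF k(1) graph_line_chord, where ?t1.0 = "x u" and ?t3.0 = "x w"])
      (use o f in \<open>auto intro: less_imp_le\<close>)
  moreover have "f (x v) < chord x y u w (x v)" if "f (x w) < y w"
    by (rule graph_line_less_between[OF k(1) graph_line_chord, where ?t1.0 = "x u" and ?t3.0 = "x w"])
      (use o f that in \<open>auto intro: less_imp_le\<close>)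
  ultimately show "chord x y v z (x v) < chord x y u w (x v)" using f by auto
  have "g (x w) \<le> chord x y v z (x w)"
    by (rule graph_line_le_between[OF k(2) graph_line_chord, where ?t1.0 = "x v" and ?t3.0 = "x z"])
      (use o g in \<open>auto intro: less_imp_le\<close>)
  moreover have "g (x w) < chord x y v z (x w)" if "g (x v) < y v"
    by (rule graph_line_less_between[OF k(2) graph_line_chord, where ?t1.0 = "x v" and ?t3.0 = "x z"])
      (use o g that in \<open>auto intro: less_imp_le\<close>)
  ultimately show "chord x y u w (x w) < chord x y v z (x w)" using g o by auto
qed (use o in auto)

text \<open>The case of two arms on different sides, \<open>P\<close> on the left and \<open>Q\<close> on the right of the points of \<open>W1\<close> and
\<open>W2\<close>.  The line \<open>\<beta>\<close> only serves to show that \<open>f\<close> is above \<open>g\<close> at \<open>l\<close>, to the left of \<open>W1\<close> and \<open>W2\<close>.  Since \<open>W1\<close>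
is between \<open>g\<close> and \<open>f\<close>, with \<open>g\<close> below, while \<open>W2\<close> is between \<open>f\<close> and \<open>g\<close>, with \<open>f\<close> below, this puts \<open>W1\<close> to
the left of \<open>W2\<close>.\<close>

lemma facing_arms_crossing_family:
  assumes inj: "inj_on x V" and sub: "P \<union> Q \<union> W1 \<union> W2 \<subseteq> V" and disj: "W1 \<inter> W2 = {}"
    and lines: "graph_line f" "graph_line g" "graph_line \<beta>"
    and PW: "\<And>p w. p \<in> P \<Longrightarrow> w \<in> W1 \<union> W2 \<Longrightarrow> x p < x w"
    and QW: "\<And>q w. q \<in> Q \<Longrightarrow> w \<in> W1 \<union> W2 \<Longrightarrow> x w < x q"
    and fP: "\<And>p. p \<in> P \<Longrightarrow> f (x p) \<le> y p" and gQ: "\<And>q. q \<in> Q \<Longrightarrow> g (x q) \<le> y q"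
    and W1: "\<And>w. w \<in> W1 \<Longrightarrow> y w \<le> f (x w)" "\<And>w. w \<in> W1 \<Longrightarrow> g (x w) \<le> y w"
    and W2: "\<And>w. w \<in> W2 \<Longrightarrow> f (x w) \<le> y w" "\<And>w. w \<in> W2 \<Longrightarrow> y w \<le> g (x w)"
    and strict: "(\<forall>w\<in>W1. y w < f (x w)) \<or> (\<forall>w\<in>W2. f (x w) < y w)"
      "(\<forall>w\<in>W1. g (x w) < y w) \<or> (\<forall>w\<in>W2. y w < g (x w))"
    and l: "\<And>w. w \<in> W1 \<union> W2 \<Longrightarrow> x l < x w" "\<beta> (x l) \<le> f (x l)"
    and r: "x l < t" "t < x r" "g t < \<beta> t" "\<beta> (x r) \<le> g (x r)"
    and card: "a \<le> card P" "a \<le> card Q" "b \<le> card W1" "b \<le> card W2" "k \<le> a * b" "0 < b"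
  shows "crossing_family x y V k"
proof (rule crossing_familyI[where A = W1 and B = P and C = Q and D = W2 and p = b and q = a and r = a and s = b])
  have gl: "g (x l) < f (x l)"
  proof (rule ccontr)
    assume "\<not> ?thesis"
    then have "\<beta> (x l) \<le> g (x l)" using l by simp
    then have "\<beta> t \<le> g t"
      using graph_line_le_between[OF lines(3,2), of "x l" t "x r"] r by simp
    then show False using r by simp
  qed
  show "crosses x y v z u w" if "v \<in> W1" "u \<in> P" "z \<in> Q" "w \<in> W2" for u v w z
  proof (rule crosses_facing_pair[where f = f and g = g])
    have "v \<noteq> w" using disj that by auto
    then have ne: "x v \<noteq> x w" using inj sub that by (auto dest!: inj_onD)
    show "x v < x w"
    proof (rule ccontr)
      assume "\<not> x v < x w"
      then have "x w < x v" using ne by simp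
      then have "g (x w) < f (x w)"
        using graph_line_less_between[OF lines(2,1), of "x l" "x w" "x v"] gl l(1) that W1[of v]
        by auto
      then show False using W2[of w] that by auto
    qed
  qed (use that PW QW fP gQ W1 W2 strict lines in auto)
  have "W1 \<noteq> {}" using card by auto
  then have "W1 \<inter> P = {}" "W2 \<inter> Q = {}" "P \<inter> W2 = {}" "W1 \<inter> Q = {}" "P \<inter> Q = {}"
    using PW QW by force+
  then show "(W1 \<union> Q) \<inter> (P \<union> W2) = {}" "W1 \<inter> Q = {}" "P \<inter> W2 = {}"
    using disj by auto
qed (use sub card in \<open>auto simp: mult.commute\<close>)

text \<open>The case of two arms on the same side, \<open>P\<close> above \<open>Q\<close> and both to the right of \<open>W1\<close> and \<open>W2\<close>.  A segment from
\<open>W1\<close> to \<open>P\<close> starts below a segment from \<open>W2\<close> to \<open>Q\<close> because of \<open>f\<close> or \<open>g\<close>, and ends above it because of \<open>\<beta>\<close>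
or \<open>\<beta>'\<close>.\<close>

lemma stacked_arms_crossing_family:
  assumes sub: "P \<union> Q \<union> W1 \<union> W2 \<subseteq> V" and disj: "W1 \<inter> W2 = {}"
    and lines: "graph_line f" "graph_line g" "graph_line \<beta>" "graph_line \<beta>'"
    and PW: "\<And>p w. p \<in> P \<union> Q \<Longrightarrow> w \<in> W1 \<union> W2 \<Longrightarrow> x w < x p"
    and \<beta>: "\<And>p. p \<in> P \<Longrightarrow> \<beta> (x p) \<le> y p" "\<And>p. p \<in> Q \<Longrightarrow> y p \<le> \<beta>' (x p)"
      "\<And>p. p \<in> P \<union> Q \<Longrightarrow> \<beta>' (x p) < \<beta> (x p)"
      "\<And>w. w \<in> W1 \<union> W2 \<Longrightarrow> \<beta>' (x w) < y w" "\<And>w. w \<in> W1 \<union> W2 \<Longrightarrow> y w < \<beta> (x w)"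
    and fP: "\<And>p. p \<in> P \<Longrightarrow> y p \<le> f (x p)" and gQ: "\<And>q. q \<in> Q \<Longrightarrow> g (x q) \<le> y q"
    and W1: "\<And>w. w \<in> W1 \<Longrightarrow> y w \<le> f (x w)" "\<And>w. w \<in> W1 \<Longrightarrow> y w \<le> g (x w)"
    and W2: "\<And>w. w \<in> W2 \<Longrightarrow> f (x w) < y w" "\<And>w. w \<in> W2 \<Longrightarrow> g (x w) < y w"
    and card: "a \<le> card P" "a \<le> card Q" "b \<le> card W1" "b \<le> card W2" "k \<le> a * b"
  shows "crossing_family x y V k"
proof (rule crossing_familyI[where A = W1 and B = W2 and C = P and D = Q and p = b and q = a and r = b and s = a])
  show "crosses x y v p w q" if "v \<in> W1" "w \<in> W2" "p \<in> P" "q \<in> Q" for v w p q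
  proof (rule crosses_if_chords_change_order[where t = "max (x v) (x w)" and t' = "min (x p) (x q)"
        and x = x and y = y])
    have o: "x v < x p" "x v < x q" "x w < x p" "x w < x q" using PW that by auto
    then show "x v < x p" "x w < x q" "x v \<le> max (x v) (x w)" "max (x v) (x w) \<le> x p"
      "x w \<le> max (x v) (x w)" "max (x v) (x w) \<le> x q" "x v \<le> min (x p) (x q)"
      "min (x p) (x q) \<le> x p" "x w \<le> min (x p) (x q)" "min (x p) (x q) \<le> x q" by auto
    show "chord x y v p (max (x v) (x w)) < chord x y w q (max (x v) (x w))"
    proof (cases "x v \<le> x w")
      case True
      have "chord x y v p (x w) \<le> f (x w)"
        by (rule graph_line_le_between[OF graph_line_chord lines(1), where ?t1.0 = "x v" and ?t3.0 = "x p"])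
          (use o True fP W1 that in \<open>auto intro: less_imp_le\<close>)
      also have "\<dots> < y w" using W2 that by auto
      finally show ?thesis using True by (simp add: max_def)
    next
      case False
      have "y v \<le> g (x v)" using W1 that by auto
      also have "\<dots> < chord x y w q (x v)"
        by (rule graph_line_less_between[OF lines(2) graph_line_chord, where ?t1.0 = "x w" and ?t3.0 = "x q"])
          (use o False gQ W2 that in \<open>auto intro: less_imp_le\<close>)
      finally show ?thesis using False by (simp add: max_def)
    qed
    have \<beta>p: "\<beta> (x p) \<le> y p" "\<beta>' (x p) < \<beta> (x p)" and \<beta>q: "y q \<le> \<beta>' (x q)" "\<beta>' (x q) < \<beta> (x q)"
      and \<beta>v: "\<beta>' (x v) < y v" "y v < \<beta> (x v)" and \<beta>w: "\<beta>' (x w) < y w" "y w < \<beta> (x w)"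
      using \<beta> that by auto
    show "chord x y w q (min (x p) (x q)) < chord x y v p (min (x p) (x q))"
    proof (cases "x p \<le> x q")
      case True
      have "chord x y w q (x p) < \<beta> (x p)"
      proof (cases "x p = x q")
        case True
        then show ?thesis using \<beta>q o by simp
      next
        case False
        show ?thesis by (rule graph_line_less_between[OF graph_line_chord lines(3), where ?t1.0 = "x w" and ?t3.0 = "x q"])
            (use False \<open>x p \<le> x q\<close> o \<beta>w \<beta>q in \<open>auto intro: less_imp_le\<close>)
      qed
      then show ?thesis using True \<beta>p o by (simp add: min_def)
    next
      case False
      have "\<beta>' (x q) < chord x y v p (x q)"
        by (rule graph_line_less_between[OF lines(4) graph_line_chord, where ?t1.0 = "x v" and ?t3.0 = "x p"])
          (use False o \<beta>v \<beta>p in \<open>auto intro: less_imp_le\<close>)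
      then show ?thesis using False \<beta>q o by (simp add: min_def)
    qed
  qed
  show "(W1 \<union> P) \<inter> (W2 \<union> Q) = {}" "W1 \<inter> P = {}" "W2 \<inter> Q = {}"
  proof -
    have 1: "(P \<union> Q) \<inter> (W1 \<union> W2) = {}" using PW less_irrefl by blast
    have "P \<inter> Q = {}"
    proof (rule ccontr)
      assume "P \<inter> Q \<noteq> {}"
      then obtain p where p: "p \<in> P" "p \<in> Q" by blast
      then show False using \<beta>(1)[OF p(1)] \<beta>(2)[OF p(2)] \<beta>(3)[of p] by simp
    qed
    with 1 disj show "(W1 \<union> P) \<inter> (W2 \<union> Q) = {}" "W1 \<inter> P = {}" "W2 \<inter> Q = {}" by blast+
  qed
qed (use sub card in \<open>auto simp: mult.commute\<close>)

text \<open>\<open>B1\<close>, \<open>B2\<close>, \<open>B3\<close>, \<open>B4\<close> will be the points of \<open>W\<close> on or below the lines of the four arms, in the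
cyclic order upper left, upper right, lower right, lower left.  If all three alternatives fail, then \<open>B2\<close> and \<open>B3\<close>
are so far from each other that \<open>B3 - B2\<close> and \<open>B2 - B3\<close> have at least \<open>2 b - 1\<close> points each, while the
differences of \<open>B1\<close> and \<open>B2\<close> and those of \<open>B3\<close> and \<open>B4\<close> have at most \<open>b - 1\<close> each, too few to
cover them.  This leaves a point in both sets of the last hypothesis.\<close>

lemma balanced_cut_pair:
  fixes W :: "'a set"
  assumes W: "finite W" "6 * b - 4 \<le> card W" and b: "0 < b"
    and B: "B1 \<subseteq> W" "B2 \<subseteq> W" "B3 \<subseteq> W" "B4 \<subseteq> W"
    and card: "card B1 = 3 * b - 2" "card B2 = 3 * b - 2" "card B3 = 3 * b - 2" "card B4 = 3 * b - 2"
    and empty: "(B3 \<inter> B4) - (B1 \<union> B2) = {} \<or> (B1 \<inter> B2) - (B3 \<union> B4) = {}"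
  shows "(b \<le> card (B1 - B2) \<and> b \<le> card (B2 - B1)) \<or> (b \<le> card (B3 - B4) \<and> b \<le> card (B4 - B3)) \<or>
    (b \<le> card (B2 \<inter> B3) \<and> b \<le> card (W - (B2 \<union> B3)))"
proof (rule ccontr)
  assume neg: "\<not> ?thesis"
  have fin: "finite B1" "finite B2" "finite B3" "finite B4" using B W finite_subset by blast+
  have diff: "card (X - Y) + card (X \<inter> Y) = card X" if "finite X" for X Y :: "'a set"
    using that card_Diff_subset_Int[of X Y] card_mono[of X "X \<inter> Y"] by simp
  have 1: "card (B1 - B2) = card (B2 - B1)" "card (B3 - B4) = card (B4 - B3)" "card (B2 - B3) = card (B3 - B2)"
    using diff[OF fin(1), of B2] diff[OF fin(2), of B1] diff[OF fin(3), of B4] diff[OF fin(4), of B3]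
      diff[OF fin(2), of B3] diff[OF fin(3), of B2] card by (simp_all add: Int_commute)
  then have 2: "card (B1 - B2) < b" "card (B2 - B1) < b" "card (B3 - B4) < b" "card (B4 - B3) < b" using neg by auto
  have "card (B2 \<union> B3) + card (B2 \<inter> B3) = 2 * (3 * b - 2)"
    using card_Un_Int[OF fin(2,3)] card by simp
  moreover have "card (W - (B2 \<union> B3)) + card (B2 \<union> B3) = card W"
    using diff[OF W(1), of "B2 \<union> B3"] B by (simp add: Int_absorb1)
  ultimately have "card (B2 \<inter> B3) < b" using neg 1 W(2) b by auto
  then have 3: "2 * b - 1 \<le> card (B2 - B3)" using diff[OF fin(2), of B3] card by simp
  have rest: "(X - Y) - (Z \<union> Z') \<noteq> {}"
    if "2 * b - 1 \<le> card (X - Y)" "card Z < b" "card Z' < b" "finite Z" "finite Z'" for X Y Z Z' :: "'a set"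
  proof
    assume "X - Y - (Z \<union> Z') = {}"
    then have "card (X - Y) \<le> card (Z \<union> Z')" using that by (intro card_mono) auto
    also have "\<dots> \<le> card Z + card Z'" by (rule card_Un_le)
    finally show False using that b by simp
  qed
  have "(B3 - B2) - ((B1 - B2) \<union> (B3 - B4)) \<noteq> {}" "(B2 - B3) - ((B2 - B1) \<union> (B4 - B3)) \<noteq> {}"
    using 1 2 3 fin by (intro rest; simp)+
  then show False using empty by blast
qed

section \<open>Four arms around a set\<close>

lemma ex_line_with_levels_right:
  assumes fin: "finite R" "finite W" and gp: "general_position x y (R \<union> W)"
    and wr: "\<And>r w. r \<in> R \<Longrightarrow> w \<in> W \<Longrightarrow> x w < x r" and i: "i < card R" and p: "p < card W"
  shows "\<exists>f r w. r \<in> R \<and> w \<in> W \<and> graph_line f \<and> f (x r) = y r \<and> f (x w) = y w \<and>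
    card {r\<in>R. y r < f (x r)} = i \<and> card {w\<in>W. y w < f (x w)} = p"
proof -
  obtain f r w where f: "r \<in> R" "w \<in> W" "graph_line f" "f (- x r) = y r" "f (- x w) = y w"
    "card {r\<in>R. y r < f (- x r)} = i" "card {w\<in>W. y w < f (- x w)} = p"
    using ex_line_with_levels[of R W "\<lambda>v. - x v" y i p] fin gp wr i p
    by (auto simp: general_position_reflect)
  then show ?thesis
    by (intro exI[of _ "\<lambda>t. f (- t)"] exI[of _ r] exI[of _ w]) (simp add: graph_line_reflect)
qed

text \<open>The line contains a point \<open>l\<close> outside \<open>W\<close>, so general position leaves room for only one point of \<open>W\<close> on it.\<close>

lemma card_on_or_below:
  assumes W: "finite W" and gp: "general_position x y (insert l W)" and l: "l \<notin> W" "f (x l) = y l"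
    and f: "graph_line f" and w: "w \<in> W" "f (x w) = y w"
  shows "card {v\<in>W. y v \<le> f (x v)} = Suc (card {v\<in>W. y v < f (x v)})"
proof -
  have "f (x v) \<noteq> y v" if "v \<in> W" "v \<noteq> w" for v
    using that l w by (intro general_position_not_on_line[OF gp, of l w] f) auto
  then have "{v\<in>W. y v \<le> f (x v)} = insert w {v\<in>W. y v < f (x v)}"
    using w by force
  then show ?thesis using W w by simp
qed

text \<open>Here \<open>l\<close> belongs to the upper arm on the left and \<open>l'\<close> to the lower one, and neither belongs to both.
If the line \<open>f\<close> through \<open>l\<close> were below the line \<open>g\<close> through \<open>l'\<close>, then \<open>g\<close> would cross \<open>\<beta>'\<close> twice in
case that \<open>l\<close> is farther to the left than \<open>l'\<close>, and \<open>f\<close> would cross \<open>\<beta>\<close> twice in the other case.\<close>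

lemma level_lines_separate_arms:
  assumes W: "finite W" and lines: "graph_line \<beta>" "graph_line \<beta>'"
    and f: "level_line x y W p f" "f (x l) = y l" and g: "level_line x y W p g" "g (x l') = y l'"
    and lw: "\<And>w. w \<in> W \<Longrightarrow> x l < x w" "\<And>w. w \<in> W \<Longrightarrow> x l' < x w"
    and \<beta>W: "\<And>w. w \<in> W \<Longrightarrow> \<beta>' (x w) < y w" "\<And>w. w \<in> W \<Longrightarrow> y w < \<beta> (x w)"
    and l: "\<beta> (x l) \<le> y l" "\<beta>' (x l) < y l" and l': "y l' \<le> \<beta>' (x l')" "y l' < \<beta> (x l')"
    and t0: "\<And>w. w \<in> W \<Longrightarrow> t0 < x w"
  shows "\<not> f t0 < g t0"
proof
  assume less: "f t0 < g t0"
  have lt: "f t < g t" if "\<And>w. w \<in> W \<Longrightarrow> t < x w" for t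
    by (rule level_lines_less_left[OF W f(1) g(1) t0 that less])
  obtain w where w: "w \<in> W" "f (x w) = y w" and fl: "graph_line f" using f by (auto simp: level_line_def)
  obtain w' where w': "w' \<in> W" "g (x w') = y w'" and gl: "graph_line g" using g by (auto simp: level_line_def)
  show False
  proof (cases "x l \<le> x l'")
    case True
    have 1: "\<beta>' (x l) < g (x l)" using lt[of "x l"] lw f(2) l by auto
    moreover have "x l \<noteq> x l'" using 1 g(2) l' by auto
    moreover have "\<beta>' (x w') < g (x w')" using \<beta>W w' by simp
    ultimately have "\<beta>' (x l') < g (x l')"
      using True lw(2)[OF w'(1)] graph_line_less_between[OF lines(2) gl, of "x l" "x l'" "x w'"] by simp
    then show False using l' g by simp
  next
    case False
    have "f (x l') < \<beta> (x l')" using lt[of "x l'"] lw g(2) l' by auto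
    moreover have "f (x w) < \<beta> (x w)" using \<beta>W w by simp
    ultimately have "f (x l) < \<beta> (x l)"
      using False lw(1)[OF w(1)] graph_line_less_between[OF fl lines(1), of "x l'" "x l" "x w"] by simp
    then show False using l f by simp
  qed
qed

lemma card_ge_rank:
  fixes h :: "'a \<Rightarrow> real"
  assumes P: "finite P" "inj_on h P" and l: "l \<in> P" and card: "card {p\<in>P. h l < h p} = i"
  shows "card {p\<in>P. h l \<le> h p} = Suc i"
proof -
  have "{p\<in>P. h l \<le> h p} = insert l {p\<in>P. h l < h p}"
    using P(2) l by (auto simp: le_less dest: inj_onD)
  then show ?thesis using P card by simp
qed

text \<open>The sets may overlap, so one can only use that an element of \<open>P\<close> alone is never lower than one of \<open>Q\<close> alone.  Take \<open>p\<close> with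
rank \<open>a\<close> from the top in \<open>P\<close> and \<open>q\<close> with rank \<open>a\<close> from the bottom in \<open>Q\<close>.  If \<open>q\<close> were higher, then more
elements of \<open>Q\<close> than of \<open>P\<close> would be as high as \<open>q\<close>, and more of \<open>P\<close> than of \<open>Q\<close> as low as
\<open>p\<close>; an element of \<open>Q\<close> alone would be above one of \<open>P\<close> alone.\<close>

lemma ex_separated_levels:
  fixes h :: "'a \<Rightarrow> real"
  assumes fin: "finite P" "finite Q" and inj: "inj_on h (P \<union> Q)"
    and card: "2 * a - 1 \<le> card P" "2 * a - 1 \<le> card Q" and a: "0 < a"
    and sep: "\<And>p q. p \<in> P - Q \<Longrightarrow> q \<in> Q - P \<Longrightarrow> h q \<le> h p"
  shows "\<exists>p\<in>P. \<exists>q\<in>Q. h q \<le> h p \<and> card {p'\<in>P. h p \<le> h p'} = a \<and> card {q'\<in>Q. h q' \<le> h q} = a"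
proof -
  have injP: "inj_on h P" "inj_on (\<lambda>v. - h v) P" and injQ: "inj_on h Q" "inj_on (\<lambda>v. - h v) Q"
    using inj by (auto simp: inj_on_def)
  have "a - 1 < card P" "a - 1 < card Q" using card a by linarith+
  then obtain p q where p: "p \<in> P" "card {p'\<in>P. h p < h p'} = a - 1"
    and q: "q \<in> Q" "card {q'\<in>Q. h q' < h q} = a - 1"
    using ex_rank[OF fin(1) injP(2)] ex_rank[OF fin(2) injQ(1)] by force
  have 1: "card {p'\<in>P. h p \<le> h p'} = a"
    using card_ge_rank[OF fin(1) injP(1) p] a by simp
  have 2: "card {q'\<in>Q. h q' \<le> h q} = a"
    using card_ge_rank[OF fin(2) injQ(2) q(1), of "a - 1"] q(2) a by simp
  have "h q \<le> h p"
  proof (rule ccontr)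
    assume "\<not> h q \<le> h p"
    then have less: "h p < h q" by simp
    have c1: "card {v\<in>Q. h q \<le> h v} + (a - 1) = card Q"
    proof -
      have "card ({v\<in>Q. h q \<le> h v} \<union> {v\<in>Q. h v < h q}) = card {v\<in>Q. h q \<le> h v} + card {v\<in>Q. h v < h q}"
        using fin by (intro card_Un_disjoint) auto
      moreover have "{v\<in>Q. h q \<le> h v} \<union> {v\<in>Q. h v < h q} = Q" by auto
      ultimately show ?thesis using q by simp
    qed
    have c2: "card {v\<in>P. h v \<le> h p} + (a - 1) = card P"
    proof -
      have "card ({v\<in>P. h v \<le> h p} \<union> {v\<in>P. h p < h v}) = card {v\<in>P. h v \<le> h p} + card {v\<in>P. h p < h v}"
        using fin by (intro card_Un_disjoint) auto
      moreover have "{v\<in>P. h v \<le> h p} \<union> {v\<in>P. h p < h v} = P" by auto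
      ultimately show ?thesis using p by simp
    qed
    have "\<not> {v\<in>Q. h q \<le> h v} \<subseteq> {v\<in>P. h p < h v}"
    proof
      assume sub: "{v\<in>Q. h q \<le> h v} \<subseteq> {v\<in>P. h p < h v}"
      have "card {v\<in>Q. h q \<le> h v} \<le> a - 1" using card_mono[OF _ sub] fin p by simp
      then show False using c1 card a by simp
    qed
    then obtain v where v: "v \<in> Q - P" "h q \<le> h v" using less by fastforce
    have "\<not> {v\<in>P. h v \<le> h p} \<subseteq> {v\<in>Q. h v < h q}"
    proof
      assume sub: "{v\<in>P. h v \<le> h p} \<subseteq> {v\<in>Q. h v < h q}"
      have "card {v\<in>P. h v \<le> h p} \<le> a - 1" using card_mono[OF _ sub] fin q by simp
      then show False using c2 card a by simp
    qed
    then obtain u where u: "u \<in> P - Q" "h u \<le> h p" using less by fastforce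
    show False using sep[OF u(1) v(1)] u v less by simp
  qed
  with 1 2 p q show ?thesis by blast
qed

text \<open>On the right, where \<open>\<beta>'\<close> is below \<open>\<beta>\<close>, the two arms are disjoint and can be used together.  On the left
the two lines may cross and the arms may overlap; there each arm is only paired with the arm
across \<open>W\<close>, and it suffices that the line of the upper arm is not below that of the lower arm.\<close>

lemma arms_crossing_family_uncrossed_right:
  assumes inj: "inj_on x V" and gp: "general_position x y V"
    and V: "finite V" "L \<union> W \<union> R \<subseteq> V"
    and LW: "\<And>l w. l \<in> L \<Longrightarrow> w \<in> W \<Longrightarrow> x l < x w" and WR: "\<And>w r. w \<in> W \<Longrightarrow> r \<in> R \<Longrightarrow> x w < x r"
    and lines: "graph_line \<beta>" "graph_line \<beta>'"
    and \<beta>W: "\<And>w. w \<in> W \<Longrightarrow> \<beta>' (x w) < y w" "\<And>w. w \<in> W \<Longrightarrow> y w < \<beta> (x w)"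
    and \<beta>R: "\<And>r. r \<in> R \<Longrightarrow> \<beta>' (x r) < \<beta> (x r)"
    and card: "2 * a - 1 \<le> card {l\<in>L. \<beta> (x l) \<le> y l}" "2 * a - 1 \<le> card {l\<in>L. y l \<le> \<beta>' (x l)}"
      "2 * a - 1 \<le> card {r\<in>R. \<beta> (x r) \<le> y r}" "2 * a - 1 \<le> card {r\<in>R. y r \<le> \<beta>' (x r)}"
      "6 * b - 4 \<le> card W" and ab: "0 < a" "0 < b" "k \<le> a * b"
  shows "crossing_family x y V k"
proof -
  define P1 P4 P2 P3 where P: "P1 = {l\<in>L. \<beta> (x l) \<le> y l}" "P4 = {l\<in>L. y l \<le> \<beta>' (x l)}"
    "P2 = {r\<in>R. \<beta> (x r) \<le> y r}" "P3 = {r\<in>R. y r \<le> \<beta>' (x r)}"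
  have fin: "finite L" "finite W" "finite R" "finite P1" "finite P2" "finite P3" "finite P4"
    using V by (auto simp: P intro: finite_subset)
  have sub: "P1 \<subseteq> L" "P4 \<subseteq> L" "P2 \<subseteq> R" "P3 \<subseteq> R" by (auto simp: P)
  \<comment> \<open>Each of the four lines passes through one point of \<open>W\<close>, so that \<open>p + 1 = 3 b - 2\<close> points of \<open>W\<close> are on or below it.\<close>
  define p where "p = 3 * b - 3"
  have p: "p < card W" "Suc p = 3 * b - 2" using card ab by (auto simp: p_def)
  have cP: "2 * a - 1 \<le> card P1" "2 * a - 1 \<le> card P2" "2 * a - 1 \<le> card P3" "2 * a - 1 \<le> card P4"
    using card by (auto simp: P)
  have Lne: "P1 \<noteq> {}" "P4 \<noteq> {}" "W \<noteq> {}" using cP ab p by auto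

  define t0 where "t0 = Max (x ` (P1 \<union> P4))"
  have t0P: "x l \<le> t0" if "l \<in> P1 \<union> P4" for l using that fin by (simp add: t0_def)
  have "t0 \<in> x ` (P1 \<union> P4)" unfolding t0_def using Lne fin by (intro Max_in) auto
  then have t0W: "t0 < x w" if "w \<in> W" for w using LW sub that by auto
  have gpL: "general_position x y (P1 \<union> P4 \<union> W)"
    by (rule general_position_subset[OF gp]; use sub V in blast)+
  obtain \<phi> where \<phi>: "\<And>l. l \<in> P1 \<union> P4 \<Longrightarrow> level_line x y W p (\<phi> l)" "\<And>l. l \<in> P1 \<union> P4 \<Longrightarrow> \<phi> l (x l) = y l"
    "inj_on (\<lambda>l. \<phi> l t0) (P1 \<union> P4)"
    "\<And>l l'. l \<in> P1 \<union> P4 \<Longrightarrow> l' \<in> P1 \<union> P4 \<Longrightarrow> y l' < \<phi> l (x l') \<longleftrightarrow> \<phi> l' t0 < \<phi> l t0"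
    using ex_level_line_pencil[OF fin(2) gpL p(1) t0P t0W] by blast
  have "\<phi> v t0 \<le> \<phi> u t0" if uv: "u \<in> P1 - P4" "v \<in> P4 - P1" for u v
  proof -
    have "\<not> \<phi> u t0 < \<phi> v t0"
    proof (rule level_lines_separate_arms[where x = x and y = y and l = u and l' = v and p = p and f = "\<phi> u" and g = "\<phi> v", OF fin(2) lines])
      show "level_line x y W p (\<phi> u)" "\<phi> u (x u) = y u" "level_line x y W p (\<phi> v)" "\<phi> v (x v) = y v"
        using \<phi>(1,2) uv by auto
      show "\<beta> (x u) \<le> y u" "\<beta>' (x u) < y u" "y v \<le> \<beta>' (x v)" "y v < \<beta> (x v)"
        using uv by (auto simp: P)
      show "x u < x w" "x v < x w" if "w \<in> W" for w using uv LW sub that by auto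
    qed (use \<beta>W t0W in auto)
    then show ?thesis by simp
  qed
  then obtain l1 l4 where l1: "l1 \<in> P1" and l4: "l4 \<in> P4" and order: "\<phi> l4 t0 \<le> \<phi> l1 t0"
    and c1: "card {l\<in>P1. \<phi> l1 t0 \<le> \<phi> l t0} = a" and c4: "card {l\<in>P4. \<phi> l t0 \<le> \<phi> l4 t0} = a"
    using ex_separated_levels[OF fin(4,7) \<phi>(3) cP(1,4) ab(1)] by blast
  \<comment> \<open>\<open>f1\<close> and \<open>f4\<close> are the lines of the upper and of the lower arm on the left.\<close>
  define f1 f4 where f14: "f1 = \<phi> l1" "f4 = \<phi> l4"
  have lev: "level_line x y W p f1" "level_line x y W p f4" "f1 (x l1) = y l1" "f4 (x l4) = y l4"
    using \<phi>(1,2) l1 l4 by (auto simp: f14)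
  define Q1 Q4 where Q14: "Q1 = {l\<in>P1. \<phi> l1 t0 \<le> \<phi> l t0}" "Q4 = {l\<in>P4. \<phi> l t0 \<le> \<phi> l4 t0}"
  have Q1: "f1 (x l) \<le> y l" if "l \<in> Q1" for l
    using \<phi>(4)[of l1 l] l1 that by (auto simp: Q14 f14)
  have Q4: "y l \<le> f4 (x l)" if "l \<in> Q4" for l
  proof (cases "\<phi> l t0 = \<phi> l4 t0")
    case True
    then have "l = l4" using inj_onD[OF \<phi>(3) True] l4 that by (auto simp: Q14)
    then show ?thesis using lev by simp
  next
    case False
    then show ?thesis using \<phi>(4)[of l4 l] l4 that by (auto simp: Q14 f14)
  qed

  \<comment> \<open>Level \<open>a - 1\<close> in an arm of \<open>2 a - 1\<close> points leaves \<open>a\<close> points on or above the line and \<open>a\<close> points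
    on or below it; both halves are needed on the right.\<close>
  have ia: "a - 1 < card P2" "a - 1 < card P3" using cP ab by linarith+
  have gpR: "general_position x y (P2 \<union> W)" "general_position x y (P3 \<union> W)"
    by (rule general_position_subset[OF gp]; use sub V in blast)+
  obtain f2 r2 w2 where f2: "r2 \<in> P2" "w2 \<in> W" "graph_line f2" "f2 (x r2) = y r2" "f2 (x w2) = y w2"
    "card {r\<in>P2. y r < f2 (x r)} = a - 1" "card {w\<in>W. y w < f2 (x w)} = p"
    using ex_line_with_levels_right[OF fin(5,2) gpR(1) _ ia(1) p(1)] WR sub by blast
  obtain f3 r3 w3 where f3: "r3 \<in> P3" "w3 \<in> W" "graph_line f3" "f3 (x r3) = y r3" "f3 (x w3) = y w3"
    "card {r\<in>P3. y r < f3 (x r)} = a - 1" "card {w\<in>W. y w < f3 (x w)} = p"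
    using ex_line_with_levels_right[OF fin(6,2) gpR(2) _ ia(2) p(1)] WR sub by blast
  have half: "a \<le> card {r\<in>Q. f (x r) \<le> y r} \<and> a \<le> card {r\<in>Q. y r \<le> f (x r)}"
    if "finite Q" "r \<in> Q" "f (x r) = y r" "card {r\<in>Q. y r < f (x r)} = a - 1" "2 * a - 1 \<le> card Q" for Q r f
  proof -
    have "card ({r\<in>Q. f (x r) \<le> y r} \<union> {r\<in>Q. y r < f (x r)}) =
        card {r\<in>Q. f (x r) \<le> y r} + card {r\<in>Q. y r < f (x r)}"
      using that by (intro card_Un_disjoint) auto
    moreover have "{r\<in>Q. f (x r) \<le> y r} \<union> {r\<in>Q. y r < f (x r)} = Q" by auto
    moreover have "card (insert r {r\<in>Q. y r < f (x r)}) \<le> card {r\<in>Q. y r \<le> f (x r)}"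
      using that by (intro card_mono) auto
    ultimately show ?thesis using that ab by simp
  qed
  note half2 = half[OF fin(5) f2(1,4,6) cP(2)] and half3 = half[OF fin(6) f3(1,4,6) cP(3)]

  define B1 B2 B3 B4 where B: "B1 = {w\<in>W. y w \<le> f1 (x w)}" "B2 = {w\<in>W. y w \<le> f2 (x w)}"
    "B3 = {w\<in>W. y w \<le> f3 (x w)}" "B4 = {w\<in>W. y w \<le> f4 (x w)}"
  have Bsub: "B1 \<subseteq> W" "B2 \<subseteq> W" "B3 \<subseteq> W" "B4 \<subseteq> W" by (auto simp: B)
  have notW: "l1 \<notin> W" "l4 \<notin> W" "r2 \<notin> W" "r3 \<notin> W"
    using LW WR sub l1 l4 f2(1) f3(1) by (metis less_irrefl subsetD)+
  have gpW: "general_position x y (insert v W)" if "v \<in> L \<union> R" for v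
    using that V by (intro general_position_subset[OF gp]) auto
  have fl: "graph_line f1" "graph_line f4" using lev by (auto simp: level_line_def)
  have cB: "card B1 = 3 * b - 2" "card B2 = 3 * b - 2" "card B3 = 3 * b - 2" "card B4 = 3 * b - 2"
  proof -
    obtain v1 where "v1 \<in> W" "f1 (x v1) = y v1" "card {w\<in>W. y w < f1 (x w)} = p"
      using lev by (auto simp: level_line_def)
    then show "card B1 = 3 * b - 2"
      using card_on_or_below[OF fin(2) gpW notW(1) lev(3) fl(1)] l1 sub p by (auto simp: B)
    obtain v4 where "v4 \<in> W" "f4 (x v4) = y v4" "card {w\<in>W. y w < f4 (x w)} = p"
      using lev by (auto simp: level_line_def)
    then show "card B4 = 3 * b - 2"
      using card_on_or_below[OF fin(2) gpW notW(2) lev(4) fl(2)] l4 sub p by (auto simp: B)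
    show "card B2 = 3 * b - 2"
      using card_on_or_below[OF fin(2) gpW notW(3) f2(4,3,2,5)] f2 sub p by (auto simp: B)
    show "card B3 = 3 * b - 2"
      using card_on_or_below[OF fin(2) gpW notW(4) f3(4,3,2,5)] f3 sub p by (auto simp: B)
  qed

  have "(B3 \<inter> B4) - (B1 \<union> B2) = {} \<or> (B1 \<inter> B2) - (B3 \<union> B4) = {}"
  proof (rule ccontr)
    assume "\<not> ?thesis"
    then obtain v w where v: "v \<in> (B3 \<inter> B4) - (B1 \<union> B2)" and w: "w \<in> (B1 \<inter> B2) - (B3 \<union> B4)" by blast
    have vw: "v \<in> W" "w \<in> W" using v w Bsub by auto
    have ne: "x v \<noteq> x w" using inj_onD[OF inj] vw v w V by blast
    \<comment> \<open>Between \<open>v\<close> and \<open>w\<close> the lines \<open>f1\<close> and \<open>f4\<close> change their order, and so do \<open>f2\<close> and \<open>f3\<close>.  On the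
      left of \<open>W\<close> the line \<open>f1\<close> is not below \<open>f4\<close>, on the right \<open>f2\<close> is not below \<open>f3\<close>.\<close>
    have v': "f1 (x v) < f4 (x v)" "f2 (x v) < f3 (x v)" and w': "f4 (x w) < f1 (x w)" "f3 (x w) < f2 (x w)"
      using v w vw by (auto simp: B)
    have o: "f4 t0 \<le> f1 t0" using order by (simp add: f14)
    show False
    proof (cases "x v < x w")
      case True
      have "f4 (x v) < f1 (x v)"
        by (rule graph_line_less_between[OF fl(2,1) t0W[OF vw(1)] True o]) (use w' in auto)
      then show False using v' by simp
    next
      case False
      then have wv: "x w < x v" using ne by simp
      \<comment> \<open>From \<open>r2\<close> on, \<open>f2\<close> stays above \<open>\<beta>\<close>, and from \<open>r3\<close> on, \<open>f3\<close> stays below \<open>\<beta>'\<close>.\<close>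
      define t where "t = max (x r2) (x r3)"
      have r: "r2 \<in> R" "r3 \<in> R" "\<beta> (x r2) \<le> y r2" "y r3 \<le> \<beta>' (x r3)" using f2(1) f3(1) by (auto simp: P)
      have t: "t = x r2 \<or> t = x r3" "x r2 \<le> t" "x r3 \<le> t" by (auto simp: t_def)
      have "\<beta> t \<le> f2 t"
      proof (rule ccontr)
        assume n: "\<not> \<beta> t \<le> f2 t"
        then have "x r2 \<noteq> t" using f2(4) r by auto
        then have "f2 (x r2) < \<beta> (x r2)"
          using graph_line_less_between[OF f2(3) lines(1), of "x w2" "x r2" t] WR[OF f2(2) r(1)] n t
            \<beta>W(2)[OF f2(2)] f2(5) by simp
        then show False using f2(4) r by simp
      qed
      moreover have "f3 t \<le> \<beta>' t"
      proof (rule ccontr)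
        assume n: "\<not> f3 t \<le> \<beta>' t"
        then have "x r3 \<noteq> t" using f3(4) r by auto
        then have "\<beta>' (x r3) < f3 (x r3)"
          using graph_line_less_between[OF lines(2) f3(3), of "x w3" "x r3" t] WR[OF f3(2) r(2)] n t
            \<beta>W(1)[OF f3(2)] f3(5) by simp
        then show False using f3(4) r by simp
      qed
      moreover have "\<beta>' t < \<beta> t" using t \<beta>R r by auto
      ultimately have "f3 t \<le> f2 t" by simp
      moreover have "x v < t" using WR[OF vw(1) r(1)] t by simp
      ultimately have "f3 (x v) < f2 (x v)"
        using graph_line_less_between[OF f3(3) f2(3) wv, of t] w' by simp
      then show False using v' by simp
    qed
  qed
  from balanced_cut_pair[OF fin(2) card(5) ab(2) Bsub cB this]
  consider (top) "b \<le> card (B1 - B2)" "b \<le> card (B2 - B1)"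
    | (bottom) "b \<le> card (B3 - B4)" "b \<le> card (B4 - B3)"
    | (right) "b \<le> card (B2 \<inter> B3)" "b \<le> card (W - (B2 \<union> B3))" by blast
  then show ?thesis
  proof cases
    case top
    show ?thesis
    proof (rule facing_arms_crossing_family[where P = Q1 and Q = "{r\<in>P2. f2 (x r) \<le> y r}"
          and ?W1.0 = "B1 - B2" and ?W2.0 = "B2 - B1" and f = f1 and g = f2 and \<beta> = \<beta>
          and l = l1 and t = "x w2" and r = r2 and a = a and b = b])
      show "a \<le> card Q1" "a \<le> card {r\<in>P2. f2 (x r) \<le> y r}" using c1 half2 by (auto simp: Q14)
      show "Q1 \<union> {r \<in> P2. f2 (x r) \<le> y r} \<union> (B1 - B2) \<union> (B2 - B1) \<subseteq> V"
        using Bsub sub V by (auto simp: Q14)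
      show "\<beta> (x l1) \<le> f1 (x l1)" "\<beta> (x r2) \<le> f2 (x r2)" using l1 f2 lev by (auto simp: P)
      show "x l1 < x w2" "x w2 < x r2" using LW WR l1 f2 sub by auto
      show "f2 (x w2) < \<beta> (x w2)" using f2 \<beta>W by auto
    qed (use inj fl f2(3) lines top ab Q1 LW WR sub l1 in \<open>auto simp: B Q14\<close>)
  next
    case bottom
    have "crossing_family x (\<lambda>v. - y v) V k"
    proof (rule facing_arms_crossing_family[where P = Q4 and Q = "{r\<in>P3. y r \<le> f3 (x r)}"
          and ?W1.0 = "B3 - B4" and ?W2.0 = "B4 - B3" and f = "\<lambda>t. - f4 t" and g = "\<lambda>t. - f3 t"
          and \<beta> = "\<lambda>t. - \<beta>' t" and l = l4 and t = "x w3" and r = r3 and a = a and b = b])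
      show "a \<le> card Q4" "a \<le> card {r\<in>P3. y r \<le> f3 (x r)}" using c4 half3 by (auto simp: Q14)
      show "Q4 \<union> {r \<in> P3. y r \<le> f3 (x r)} \<union> (B3 - B4) \<union> (B4 - B3) \<subseteq> V"
        using Bsub sub V by (auto simp: Q14)
      show "- \<beta>' (x l4) \<le> - f4 (x l4)" "- \<beta>' (x r3) \<le> - f3 (x r3)" using l4 f3 lev by (auto simp: P)
      show "x l4 < x w3" "x w3 < x r3" using LW WR l4 f3 sub by auto
      show "- f3 (x w3) < - \<beta>' (x w3)" using f3 \<beta>W by auto
      show "graph_line (\<lambda>t. - f4 t)" "graph_line (\<lambda>t. - f3 t)" "graph_line (\<lambda>t. - \<beta>' t)"
        using fl f3 lines by (auto intro: graph_line_uminus)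
    qed (use inj bottom ab Q4 LW WR sub l4 in \<open>auto simp: B Q14\<close>)
    then show ?thesis by (simp add: crossing_family_reflect)
  next
    case right
    show ?thesis
    proof (rule stacked_arms_crossing_family[where P = "{r\<in>P2. y r \<le> f2 (x r)}" and Q = "{r\<in>P3. f3 (x r) \<le> y r}"
          and ?W1.0 = "B2 \<inter> B3" and ?W2.0 = "W - (B2 \<union> B3)" and f = f2 and g = f3 and \<beta> = \<beta> and \<beta>' = \<beta>'
          and a = a and b = b])
      show "a \<le> card {r \<in> P2. y r \<le> f2 (x r)}" "a \<le> card {r \<in> P3. f3 (x r) \<le> y r}"
        using half2 half3 by auto
      show "{r \<in> P2. y r \<le> f2 (x r)} \<union> {r \<in> P3. f3 (x r) \<le> y r} \<union> B2 \<inter> B3 \<union> (W - (B2 \<union> B3)) \<subseteq> V"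
        using Bsub sub V by auto
    qed (use f2 f3 lines right ab WR sub \<beta>W \<beta>R in \<open>auto simp: B P\<close>)
  qed
qed

text \<open>The lines \<open>\<beta>\<close> and \<open>\<beta>'\<close> cross at most once and not between two points of \<open>W\<close>, so they do not cross on one of
the two sides; a reflection makes it the right one.\<close>

lemma arms_crossing_family:
  assumes inj: "inj_on x V" and gp: "general_position x y V"
    and V: "finite V" "L \<union> W \<union> R \<subseteq> V"
    and LW: "\<And>l w. l \<in> L \<Longrightarrow> w \<in> W \<Longrightarrow> x l < x w" and WR: "\<And>w r. w \<in> W \<Longrightarrow> r \<in> R \<Longrightarrow> x w < x r"
    and lines: "graph_line \<beta>" "graph_line \<beta>'"
    and \<beta>W: "\<And>w. w \<in> W \<Longrightarrow> \<beta>' (x w) < y w" "\<And>w. w \<in> W \<Longrightarrow> y w < \<beta> (x w)"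
    and card: "2 * a - 1 \<le> card {l\<in>L. \<beta> (x l) \<le> y l}" "2 * a - 1 \<le> card {l\<in>L. y l \<le> \<beta>' (x l)}"
      "2 * a - 1 \<le> card {r\<in>R. \<beta> (x r) \<le> y r}" "2 * a - 1 \<le> card {r\<in>R. y r \<le> \<beta>' (x r)}"
      "6 * b - 4 \<le> card W" and ab: "0 < a" "0 < b" "k \<le> a * b"
  shows "crossing_family x y V k"
proof (cases "\<forall>r\<in>R. \<beta>' (x r) < \<beta> (x r)")
  case True
  then show ?thesis using arms_crossing_family_uncrossed_right[OF inj gp V LW WR lines \<beta>W _ card ab] by blast
next
  case False
  then obtain r where r: "r \<in> R" "\<beta> (x r) \<le> \<beta>' (x r)" by force
  have "W \<noteq> {}" using card(5) ab(2) by auto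
  then obtain w where w: "w \<in> W" by blast
  have \<beta>L: "\<beta>' (x l) < \<beta> (x l)" if "l \<in> L" for l
  proof (rule ccontr)
    assume "\<not> \<beta>' (x l) < \<beta> (x l)"
    then have "\<beta> (x w) \<le> \<beta>' (x w)"
      using graph_line_le_between[OF lines, of "x l" "x w" "x r"] LW[OF that w] WR[OF w r(1)] r(2) by simp
    then show False using \<beta>W[OF w] by simp
  qed
  have "crossing_family (\<lambda>v. - x v) y V k"
    by (rule arms_crossing_family_uncrossed_right[where L = R and R = L and W = W and \<beta> = "\<lambda>t. \<beta> (- t)" and \<beta>' = "\<lambda>t. \<beta>' (- t)"
          and a = a and b = b])
       (use inj gp V LW WR lines \<beta>W card ab \<beta>L in
         \<open>auto simp: general_position_reflect graph_line_reflect inj_on_def\<close>)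
  then show ?thesis by (simp add: crossing_family_reflect)
qed

section \<open>The position of the middle set\<close>

definition leftmost :: "('a \<Rightarrow> real) \<Rightarrow> 'a set \<Rightarrow> nat \<Rightarrow> 'a set" where
  "leftmost x V q = {v\<in>V. card {u\<in>V. x u < x v} < q}"

abbreviation rightmost :: "('a \<Rightarrow> real) \<Rightarrow> 'a set \<Rightarrow> nat \<Rightarrow> 'a set" where
  "rightmost x \<equiv> leftmost (\<lambda>v. - x v)"

lemma leftmost_subset: "leftmost x V q \<subseteq> V"
  by (auto simp: leftmost_def)

lemma leftmost_less:
  assumes V: "finite V" and u: "u \<in> leftmost x V q" and v: "v \<in> V - leftmost x V q"
  shows "x u < x v"
proof (rule ccontr)
  assume "\<not> x u < x v"
  then have "card {w\<in>V. x w < x v} \<le> card {w\<in>V. x w < x u}"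
    using V by (intro card_mono) auto
  then show False using u v by (auto simp: leftmost_def)
qed

lemma card_leftmost:
  assumes V: "finite V" and inj: "inj_on x V" and q: "q \<le> card V"
  shows "card (leftmost x V q) = q"
proof (cases "q = card V")
  case True
  have "card {u\<in>V. x u < x v} < card V" if "v \<in> V" for v
    using V that by (intro psubset_card_mono) auto
  then have "leftmost x V q = V" using True by (auto simp: leftmost_def)
  then show ?thesis using True by simp
next
  case False
  then obtain a where a: "a \<in> V" "card {u\<in>V. x u < x a} = q"
    using ex_rank[OF V inj, of q] q by auto
  have "card {u\<in>V. x u < x v} < q \<longleftrightarrow> x v < x a" if v: "v \<in> V" for v
  proof
    assume "card {u\<in>V. x u < x v} < q"
    show "x v < x a"
    proof (rule ccontr)
      assume "\<not> x v < x a"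
      then have "card {u\<in>V. x u < x a} \<le> card {u\<in>V. x u < x v}"
        using V by (intro card_mono) auto
      then show False using a \<open>card {u\<in>V. x u < x v} < q\<close> by simp
    qed
  next
    assume "x v < x a"
    then have "card {u\<in>V. x u < x v} < card {u\<in>V. x u < x a}"
      using V v by (intro psubset_card_mono) auto
    then show "card {u\<in>V. x u < x v} < q" using a by simp
  qed
  then have "leftmost x V q = {u\<in>V. x u < x a}" by (auto simp: leftmost_def)
  then show ?thesis using a by simp
qed

lemma inj_on_uminus: "inj_on (\<lambda>v. - x v :: real) V \<longleftrightarrow> inj_on x V"
  by (auto simp: inj_on_def)

lemma rightmost_less:
  assumes "finite V" "u \<in> rightmost x V q" "v \<in> V - rightmost x V q"
  shows "x v < x u"
  using leftmost_less[of V u "\<lambda>v. - x v" q v] assms by simp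

lemma card_rightmost: "finite V \<Longrightarrow> inj_on x V \<Longrightarrow> q \<le> card V \<Longrightarrow> card (rightmost x V q) = q"
  by (intro card_leftmost) (simp_all add: inj_on_uminus)

lemma leftmost_rightmost_disjoint:
  assumes V: "finite V" and inj: "inj_on x V" and q: "2 * q \<le> card V"
  shows "leftmost x V q \<inter> rightmost x V q = {}"
proof (rule ccontr)
  assume "\<not> ?thesis"
  then obtain v where v: "v \<in> V" "card {u\<in>V. x u < x v} < q" "card {u\<in>V. x v < x u} < q"
    by (auto simp: leftmost_def)
  have "V \<subseteq> insert v ({u\<in>V. x u < x v} \<union> {u\<in>V. x v < x u})"
  proof
    fix u assume "u \<in> V"
    then show "u \<in> insert v ({u\<in>V. x u < x v} \<union> {u\<in>V. x v < x u})"
      using inj_onD[OF inj, of u v] v(1) by (cases "x u" "x v" rule: linorder_cases) auto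
  qed
  then have "card V \<le> card (insert v ({u\<in>V. x u < x v} \<union> {u\<in>V. x v < x u}))"
    using V by (intro card_mono) auto
  also have "\<dots> \<le> Suc (card ({u\<in>V. x u < x v} \<union> {u\<in>V. x v < x u}))"
    using V by (simp add: card_insert_if)
  also have "\<dots> \<le> Suc (card {u\<in>V. x u < x v} + card {u\<in>V. x v < x u})"
    using card_Un_le by blast
  finally show False using v q by simp
qed

text \<open>A line that leaves \<open>s\<close> of the \<open>q\<close> leftmost and \<open>s\<close> of the \<open>q\<close> rightmost points on or above it, but fewer
than \<open>b\<close> of the points in the middle.  The opposite situation, a middle that is high, is the
same property after a rotation by \<open>\<pi>\<close>, that is, for the negated coordinates.\<close>

definition low_middle :: "('a \<Rightarrow> real) \<Rightarrow> ('a \<Rightarrow> real) \<Rightarrow> 'a set \<Rightarrow> nat \<Rightarrow> nat \<Rightarrow> nat \<Rightarrow> bool" where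
  "low_middle x y V q s b \<longleftrightarrow> (\<exists>\<beta>. graph_line \<beta> \<and>
     s \<le> card {v \<in> leftmost x V q. \<beta> (x v) \<le> y v} \<and> s \<le> card {v \<in> rightmost x V q. \<beta> (x v) \<le> y v} \<and>
     card {v \<in> V - leftmost x V q - rightmost x V q. \<beta> (x v) \<le> y v} < b)"

lemma card_le_plus_card_gt:
  assumes "finite A" shows "card {v\<in>A. f v \<le> g v} + card {v\<in>A. g v < (f v :: real)} = card A"
proof -
  have "card ({v\<in>A. f v \<le> g v} \<union> {v\<in>A. g v < f v}) = card {v\<in>A. f v \<le> g v} + card {v\<in>A. g v < f v}"
    using assms by (intro card_Un_disjoint) auto
  moreover have "{v\<in>A. f v \<le> g v} \<union> {v\<in>A. g v < f v} = A" by auto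
  ultimately show ?thesis by simp
qed

text \<open>A segment from \<open>L\<close> to \<open>R\<close> whose ends are between a lower and an upper line separates the points of the middle
above the upper line from those below the lower one.  So there is a crossing family unless one
of these two sets has fewer than \<open>b\<close> points.\<close>

lemma crossing_family_or_low_middle:
  assumes V: "finite V" and inj: "inj_on x V" and gp: "general_position x y V"
    and ab: "0 < a" "0 < b" and q: "q = 4 * a + b - 2" "2 * q \<le> card V"
  shows "crossing_family x y V (b * b) \<or> low_middle x y V q (2 * a) b \<or>
    low_middle (\<lambda>v. - x v) (\<lambda>v. - y v) V q (2 * a) b"
proof -
  define L R where "L = leftmost x V q" and "R = rightmost x V q"
  define M where "M = V - L - R"
  have sub: "L \<subseteq> V" "R \<subseteq> V" "M \<subseteq> V" by (auto simp: L_def R_def M_def leftmost_subset[THEN subsetD])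
  have fin: "finite L" "finite R" "finite M" using sub V by (auto intro: finite_subset)
  have cLR: "card L = q" "card R = q"
    using card_leftmost[OF V inj] card_rightmost[OF V inj] q by (auto simp: L_def R_def)
  have disj: "L \<inter> R = {}" using leftmost_rightmost_disjoint[OF V inj q(2)] by (simp add: L_def R_def)
  have LM: "x l < x m" if "l \<in> L" "m \<in> M" for l m
    using leftmost_less[OF V] that by (auto simp: L_def M_def)
  have MR: "x m < x r" if "m \<in> M" "r \<in> R" for m r
    using rightmost_less[OF V] that by (auto simp: R_def M_def)
  have LR: "x l < x r" if "l \<in> L" "r \<in> R" for l r
    using leftmost_less[OF V, of l x q r] that disj sub by (auto simp: L_def)
  have gpLR: "general_position x y (L \<union> R)" using general_position_subset[OF gp] sub by simp
  \<comment> \<open>The line of level \<open>i\<close> has \<open>i + 1 = 2 a\<close> points of \<open>L\<close> on or below it, the line of level \<open>j\<close> has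
    \<open>q - j = 2 a\<close> points on or above it, and \<open>j + 1 - i = b\<close> points are between them.\<close>
  define i j where "i = 2 * a - 1" and "j = 2 * a + b - 2"
  have ij: "i < q" "j < q" "q - j = 2 * a" "Suc i = 2 * a" "q - i - (q - Suc j) = b"
    using ab by (auto simp: i_def j_def q)
  obtain f l r where f: "l \<in> L" "r \<in> R" "graph_line f" "f (x l) = y l" "f (x r) = y r"
    "card {l\<in>L. y l < f (x l)} = i" "card {r\<in>R. y r < f (x r)} = i"
    using ex_line_with_levels[OF fin(1,2) gpLR LR, of i i] ij cLR by auto
  obtain g l' r' where g: "l' \<in> L" "r' \<in> R" "graph_line g" "g (x l') = y l'" "g (x r') = y r'"
    "card {l\<in>L. y l < g (x l)} = j" "card {r\<in>R. y r < g (x r)} = j"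
    using ex_line_with_levels[OF fin(1,2) gpLR LR, of j j] ij cLR by auto
  have closed: "card {v\<in>A. y v \<le> h (x v)} = Suc (card {v\<in>A. y v < h (x v)})"
    if "A \<subseteq> V" "u \<in> V - A" "h (x u) = y u" "graph_line h" "w \<in> A" "h (x w) = y w" for A h u w
    using that V by (intro card_on_or_below[of _ _ _ u _ w] general_position_subset[OF gp])
      (auto intro: finite_subset)
  have fM: "f (x m) \<noteq> y m" and gM: "g (x m) \<noteq> y m" if "m \<in> M" for m
  proof -
    have d: "l \<noteq> r" "l \<noteq> m" "r \<noteq> m" "l' \<noteq> r'" "l' \<noteq> m" "r' \<noteq> m"
      using f(1,2) g(1,2) disj that by (auto simp: M_def)
    have V: "l \<in> V" "r \<in> V" "l' \<in> V" "r' \<in> V" "m \<in> V" using f(1,2) g(1,2) sub that by auto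
    show "f (x m) \<noteq> y m"
      by (rule general_position_not_on_line[OF gp V(1,2,5) d(1-3) f(3-5)])
    show "g (x m) \<noteq> y m"
      by (rule general_position_not_on_line[OF gp V(3,4,5) d(4-6) g(3-5)])
  qed
  define D U where "D = {m\<in>M. y m < f (x m)}" and "U = {m\<in>M. g (x m) < y m}"
  consider "card U < b" | "card D < b" | "b \<le> card U" "b \<le> card D" by linarith
  then show ?thesis
  proof cases
    case 1
    have "{m\<in>M. g (x m) \<le> y m} = U" using gM by (force simp: U_def)
    moreover have "card {v\<in>L. g (x v) \<le> y v} = 2 * a" "card {v\<in>R. g (x v) \<le> y v} = 2 * a"
      using card_le_plus_card_gt[OF fin(1), of "\<lambda>v. g (x v)" y] card_le_plus_card_gt[OF fin(2), of "\<lambda>v. g (x v)" y]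
        g(6,7) cLR ij by simp_all
    ultimately have "low_middle x y V q (2 * a) b"
      unfolding low_middle_def using 1 g(3)
      by (intro exI[of _ g]) (simp add: L_def[symmetric] R_def[symmetric] M_def[symmetric])
    then show ?thesis by simp
  next
    case 2
    have "{m\<in>M. y m \<le> f (x m)} = D" using fM by (force simp: D_def)
    moreover have "{v \<in> V - R - L. y v \<le> f (x v)} = {m\<in>M. y m \<le> f (x m)}" by (auto simp: M_def)
    moreover have "card {v\<in>L. y v \<le> f (x v)} = 2 * a" "card {v\<in>R. y v \<le> f (x v)} = 2 * a"
      using closed[OF sub(1) _ f(5,3,1,4)] closed[OF sub(2) _ f(4,3,2,5)] f disj sub ij by auto
    ultimately have "low_middle (\<lambda>v. - x v) (\<lambda>v. - y v) V q (2 * a) b"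
      unfolding low_middle_def using 2 f(3)
      by (intro exI[of _ "\<lambda>t. - f (- t)"])
         (simp add: L_def[symmetric] R_def[symmetric] graph_line_uminus graph_line_reflect)
    then show ?thesis by simp
  next
    case 3
    define band where "band A = {v\<in>A. f (x v) \<le> y v \<and> y v \<le> g (x v)}" for A
    have card_band: "b \<le> card (band A)"
      if A: "finite A" "card A = q" "card {v\<in>A. y v < f (x v)} = i" "card {v\<in>A. y v \<le> g (x v)} = Suc j" for A
    proof -
      have "card {v\<in>A. f (x v) \<le> y v} = q - i"
        using card_le_plus_card_gt[OF A(1), of "\<lambda>v. f (x v)" y] A by simp
      moreover have "card {v\<in>A. g (x v) < y v} = q - Suc j"
        using card_le_plus_card_gt[OF A(1), of y "\<lambda>v. g (x v)"] A by simp
      moreover have "{v\<in>A. f (x v) \<le> y v} \<subseteq> band A \<union> {v\<in>A. g (x v) < y v}" by (auto simp: band_def)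
      then have "card {v\<in>A. f (x v) \<le> y v} \<le> card (band A) + card {v\<in>A. g (x v) < y v}"
        using A(1) by (intro order_trans[OF card_mono card_Un_le]) (auto simp: band_def)
      ultimately show ?thesis using ij by simp
    qed
    have "card {v\<in>L. y v \<le> g (x v)} = Suc j" "card {v\<in>R. y v \<le> g (x v)} = Suc j"
      using closed[OF sub(1) _ g(5,3,1,4)] closed[OF sub(2) _ g(4,3,2,5)] g disj sub by auto
    then have cb: "b \<le> card (band L)" "b \<le> card (band R)"
      using card_band fin cLR f(6,7) by auto
    have bsub: "band L \<subseteq> L" "band R \<subseteq> R" by (auto simp: band_def)
    have DU: "D \<subseteq> M" "U \<subseteq> M" by (auto simp: D_def U_def)
    have "crossing_family x y V (b * b)"
    proof (rule crossing_familyI[where A = "band L" and C = "band R" and B = U and D = D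
          and p = b and q = b and r = b and s = b])
      show "crosses x y v w u d" if "v \<in> band L" "u \<in> U" "w \<in> band R" "d \<in> D" for v u w d
      proof (rule crosses_opposite_sides)
        have o: "x v < x u" "x u < x w" "x v < x d" "x d < x w"
          using that LM MR bsub DU by blast+
        then show "x v < x u" "x u < x w" "x v < x d" "x d < x w" .
        have 1: "chord x y v w (x u) \<le> g (x u)"
          by (rule graph_line_le_between[OF graph_line_chord g(3), where ?t1.0 = "x v" and ?t3.0 = "x w"])
             (use o that in \<open>auto simp: band_def\<close>)
        then show "chord x y v w (x u) < y u" using that by (auto simp: U_def)
        have 2: "f (x d) \<le> chord x y v w (x d)"
          by (rule graph_line_le_between[OF f(3) graph_line_chord, where ?t1.0 = "x v" and ?t3.0 = "x w"])
             (use o that in \<open>auto simp: band_def\<close>)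
        then show "y d < chord x y v w (x d)" using that by (auto simp: D_def)
      qed
      show "U \<inter> D = {}"
      proof (rule ccontr)
        assume "U \<inter> D \<noteq> {}"
        then obtain m where m: "m \<in> U" "m \<in> D" by blast
        obtain v w where vw: "v \<in> band L" "w \<in> band R" using cb ab by fastforce
        have "x v < x m" "x m < x w" using vw m LM MR bsub DU by blast+
        then have "f (x m) \<le> g (x m)"
          using graph_line_le_between[OF f(3) g(3), of "x v" "x m" "x w"] vw by (auto simp: band_def)
        then show False using m by (auto simp: U_def D_def)
      qed
      show "(band L \<union> band R) \<inter> (U \<union> D) = {}" using bsub DU by (auto simp: M_def)
      show "band L \<inter> band R = {}" using bsub disj by auto
      show "band L \<union> U \<union> band R \<union> D \<subseteq> V" using bsub DU sub by auto
    qed (use 3 cb in auto)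
    then show ?thesis by simp
  qed
qed

section \<open>Changing the direction\<close>

text \<open>Twice the signed area of the triangle, hence unchanged by rotations.\<close>

definition turn :: "('a \<Rightarrow> real) \<Rightarrow> ('a \<Rightarrow> real) \<Rightarrow> 'a \<Rightarrow> 'a \<Rightarrow> 'a \<Rightarrow> real" where
  "turn x y u v w = (x v - x u) * (y w - y u) - (x w - x u) * (y v - y u)"

text \<open>\<open>frame_x z\<close> and \<open>frame_y z\<close> are the coordinates, up to the factor \<open>cmod z\<close>, in the system whose
first axis has the direction of \<open>z\<close>.\<close>

definition frame_x :: "complex \<Rightarrow> ('a \<Rightarrow> real) \<Rightarrow> ('a \<Rightarrow> real) \<Rightarrow> 'a \<Rightarrow> real" where
  "frame_x z x y v = Re z * x v + Im z * y v"

definition frame_y :: "complex \<Rightarrow> ('a \<Rightarrow> real) \<Rightarrow> ('a \<Rightarrow> real) \<Rightarrow> 'a \<Rightarrow> real" where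
  "frame_y z x y v = - Im z * x v + Re z * y v"

lemma frame_mult:
  "frame_x z (frame_x w x y) (frame_y w x y) = frame_x (z * w) x y"
  "frame_y z (frame_x w x y) (frame_y w x y) = frame_y (z * w) x y"
  by (auto simp: frame_x_def frame_y_def fun_eq_iff algebra_simps)

lemma frame_1: "frame_x 1 x y = x" "frame_y 1 x y = y"
  by (auto simp: frame_x_def frame_y_def)

lemma frame_uminus: "frame_x (- z) x y = (\<lambda>v. - frame_x z x y v)" "frame_y (- z) x y = (\<lambda>v. - frame_y z x y v)"
  by (auto simp: frame_x_def frame_y_def)

lemma turn_frame: "turn (frame_x z x y) (frame_y z x y) u v w = (cmod z)\<^sup>2 * turn x y u v w"
  unfolding turn_def frame_x_def frame_y_def cmod_power2 by (simp add: algebra_simps power2_eq_square)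

lemma general_position_turn:
  "general_position x y V \<longleftrightarrow> (\<forall>u\<in>V. \<forall>v\<in>V. \<forall>w\<in>V. u \<noteq> v \<and> u \<noteq> w \<and> v \<noteq> w \<longrightarrow> turn x y u v w \<noteq> 0)"
  by (simp add: general_position_def turn_def)

lemma general_position_frame:
  "z \<noteq> 0 \<Longrightarrow> general_position (frame_x z x y) (frame_y z x y) V \<longleftrightarrow> general_position x y V"
  by (simp add: general_position_turn turn_frame)

lemma crosses_frame_imp:
  assumes "crosses x y a c b d" shows "crosses (frame_x z x y) (frame_y z x y) a c b d"
proof -
  obtain \<alpha> \<beta> where 1: "0 < \<alpha>" "\<alpha> < 1" "0 < \<beta>" "\<beta> < 1"
    "(1 - \<alpha>) * x a + \<alpha> * x c = (1 - \<beta>) * x b + \<beta> * x d"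
    "(1 - \<alpha>) * y a + \<alpha> * y c = (1 - \<beta>) * y b + \<beta> * y d"
    using assms by (auto simp: crosses_def)
  have comb: "(1 - t) * (p * u + q * v) + t * (p * u' + q * v') =
      p * ((1 - t) * u + t * u') + q * ((1 - t) * v + t * v')" for t p q u v u' v' :: real
    by (simp add: algebra_simps)
  show ?thesis unfolding crosses_def frame_x_def frame_y_def comb
    using 1 by (intro exI[of _ \<alpha>] exI[of _ \<beta>]) simp
qed

lemma crosses_frame:
  assumes "z \<noteq> 0" shows "crosses (frame_x z x y) (frame_y z x y) = crosses x y"
proof (intro ext iffI)
  fix a c b d assume "crosses (frame_x z x y) (frame_y z x y) a c b d"
  then show "crosses x y a c b d"
    using crosses_frame_imp[of _ _ a c b d "inverse z"] assms by (fastforce simp: frame_mult frame_1)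
qed (rule crosses_frame_imp)

lemma crossing_family_frame:
  "z \<noteq> 0 \<Longrightarrow> crossing_family (frame_x z x y) (frame_y z x y) V k \<longleftrightarrow> crossing_family x y V k"
  by (simp add: crossing_family_def crosses_frame)

lemma turn_neg_if_above:
  assumes f: "graph_line f" and x: "x l < x m" "x m < x r"
    and y: "y l \<le> f (x l)" "y r \<le> f (x r)" "f (x m) < y m"
  shows "turn x y l m r < 0"
proof -
  have "(x r - x l) * f (x m) = (x r - x m) * f (x l) + (x m - x l) * f (x r)"
    by (rule graph_line_weighted[OF f])
  moreover have "(x r - x m) * y l \<le> (x r - x m) * f (x l)" "(x m - x l) * y r \<le> (x m - x l) * f (x r)"
    using x y by (auto intro: mult_left_mono)
  moreover have "(x r - x l) * f (x m) < (x r - x l) * y m"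
    using x y by (intro mult_strict_left_mono) auto
  ultimately have "(x r - x m) * y l + (x m - x l) * y r < (x r - x l) * y m" by linarith
  then show ?thesis by (simp add: turn_def algebra_simps)
qed

text \<open>A line that is not vertical in one frame may be vertical or upside down in another one.  This
is excluded by a point \<open>m\<close> above the line that is between two points \<open>l\<close> and \<open>r\<close> on or below it in both frames,
because the orientation of the triangle \<open>l m r\<close> does not depend on the frame.\<close>

lemma graph_line_in_frame:
  assumes z: "z \<noteq> 0" and f: "graph_line f"
    and x: "x l < x m" "x m < x r"
    and X: "frame_x z x y l < frame_x z x y m" "frame_x z x y m < frame_x z x y r"
    and Y: "frame_y z x y l \<le> f (frame_x z x y l)" "frame_y z x y r \<le> f (frame_x z x y r)"
      "f (frame_x z x y m) < frame_y z x y m"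
  shows "\<exists>g. graph_line g \<and> (\<forall>v. frame_y z x y v \<le> f (frame_x z x y v) \<longleftrightarrow> y v \<le> g (x v))"
proof -
  obtain s c where s: "f = (\<lambda>t. s * t + c)" using f by (auto simp: graph_line_def)
  define \<kappa> where "\<kappa> = Re z - s * Im z"
  define \<sigma> where "\<sigma> = Im z + s * Re z"
  define h where "h v = \<kappa> * y v - \<sigma> * x v - c" for v
  have h: "frame_y z x y v - f (frame_x z x y v) = h v" for v
    by (simp add: frame_x_def frame_y_def s h_def \<kappa>_def \<sigma>_def algebra_simps)
  have "turn (frame_x z x y) (frame_y z x y) l m r < 0" by (rule turn_neg_if_above[OF f X Y])
  then have neg: "turn x y l m r < 0" using z by (simp add: turn_frame mult_less_0_iff)
  have "0 < \<kappa>"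
  proof (rule ccontr)
    assume "\<not> 0 < \<kappa>"
    then have "0 \<le> \<kappa> * turn x y l m r" using neg by (simp add: mult_nonpos_nonpos)
    moreover have "(x r - x l) * h m = (x r - x m) * h l + (x m - x l) * h r - \<kappa> * turn x y l m r"
      by (simp add: h_def turn_def algebra_simps)
    moreover have "(x r - x m) * h l \<le> 0" "(x m - x l) * h r \<le> 0" "0 < (x r - x l) * h m"
      using x Y h[of l] h[of r] h[of m] by (auto simp: mult_le_0_iff)
    ultimately show False by linarith
  qed
  have "frame_y z x y v \<le> f (frame_x z x y v) \<longleftrightarrow> y v \<le> (\<sigma> / \<kappa>) * x v + c / \<kappa>" for v
  proof -
    have "frame_y z x y v \<le> f (frame_x z x y v) \<longleftrightarrow> h v \<le> 0" using h[of v] by linarith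
    also have "\<dots> \<longleftrightarrow> y v * \<kappa> \<le> \<sigma> * x v + c" unfolding h_def by (auto simp: algebra_simps)
    also have "\<dots> \<longleftrightarrow> y v \<le> (\<sigma> * x v + c) / \<kappa>" using \<open>0 < \<kappa>\<close> by (simp add: pos_le_divide_eq)
    also have "(\<sigma> * x v + c) / \<kappa> = (\<sigma> / \<kappa>) * x v + c / \<kappa>" by (simp add: add_divide_distrib)
    finally show ?thesis .
  qed
  then show ?thesis unfolding graph_line_def by blast
qed

text \<open>The orders by \<open>x\<close> and by \<open>x'\<close> both refine the one by \<open>x0\<close>, and at most two points are tied in
the latter.  A point that leaves the set of the leftmost points must be tied with each point that enters
it, so there is only one.\<close>

lemma card_leftmost_diff_le_1:
  assumes V: "finite V" and inj: "inj_on x V" "inj_on x' V" and q: "q \<le> card V"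
    and cons: "\<And>u v. u \<in> V \<Longrightarrow> v \<in> V \<Longrightarrow> x0 u < x0 v \<Longrightarrow> x u < x v \<and> x' u < (x' v :: real)"
    and ties: "\<And>u v w. u \<in> V \<Longrightarrow> v \<in> V \<Longrightarrow> w \<in> V \<Longrightarrow> u \<noteq> v \<Longrightarrow> u \<noteq> w \<Longrightarrow> v \<noteq> w \<Longrightarrow>
      \<not> (x0 u = x0 v \<and> x0 u = (x0 w :: real))"
  shows "card (leftmost x V q - leftmost x' V q) \<le> 1"
proof -
  define L L' where "L = leftmost x V q" and "L' = leftmost x' V q"
  have sub: "L \<subseteq> V" "L' \<subseteq> V" by (simp_all add: L_def L'_def leftmost_subset)
  have fin: "finite L" "finite L'" using sub V by (auto intro: finite_subset)
  have card: "card L = q" "card L' = q"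
    using card_leftmost[OF V inj(1) q] card_leftmost[OF V inj(2) q] by (auto simp: L_def L'_def)
  have tie: "x0 u = x0 v" if "u \<in> L - L'" "v \<in> L' - L" for u v
  proof -
    have "x u < x v" "x' v < x' u"
      using leftmost_less[OF V, of u x q v] leftmost_less[OF V, of v x' q u] that sub
      by (auto simp: L_def L'_def)
    then show ?thesis using cons[of u v] cons[of v u] that sub by (cases "x0 u" "x0 v" rule: linorder_cases) auto
  qed
  have "card (L - L') = card (L' - L)"
    using card_Diff_subset_Int[of L L'] card_Diff_subset_Int[of L' L] fin card by (simp add: Int_commute)
  show ?thesis
  proof (rule ccontr)
    assume "\<not> ?thesis"
    then have 2: "2 \<le> card (L - L')" by (simp add: L_def L'_def)
    then have "\<not> card (L - L') \<le> Suc 0" by simp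
    then obtain u v where uv: "u \<in> L - L'" "v \<in> L - L'" "u \<noteq> v"
      using card_le_Suc0_iff_eq[of "L - L'"] fin by auto
    have "L' - L \<noteq> {}" using 2 \<open>card (L - L') = card (L' - L)\<close> by (metis card.empty not_numeral_le_zero)
    then obtain w where w: "w \<in> L' - L" by blast
    show False using ties[of u v w] tie[OF uv(1) w] tie[OF uv(2) w] uv w sub by auto
  qed
qed

text \<open>The two lines for the common middle \<open>W\<close> come from different frames: the upper one from \<open>low\<close>, the
lower one from \<open>high\<close>.  Each arm loses at most one of its \<open>2 a\<close> points because \<open>L\<close> and \<open>R\<close> differ in the two
frames.  The middle loses at most two points for this reason, and at most \<open>b - 1\<close> for each line.\<close>

lemma low_and_high_middle_crossing_family:
  fixes x y :: "'a \<Rightarrow> real"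
  assumes V: "finite V" and gp: "general_position x y V" and z: "z \<noteq> 0"
    and inj: "inj_on x V" "inj_on (frame_x z x y) V"
    and n: "2 * q + 8 * b - 4 \<le> card V" and ab: "0 < a" "0 < b" "k \<le> a * b"
    and diff: "card (leftmost x V q - leftmost (frame_x z x y) V q) \<le> 1"
      "card (rightmost x V q - rightmost (frame_x z x y) V q) \<le> 1"
    and low: "low_middle x y V q (2 * a) b"
    and high: "low_middle (\<lambda>v. - frame_x z x y v) (\<lambda>v. - frame_y z x y v) V q (2 * a) b"
  shows "crossing_family x y V k"
proof -
  define x' y' where "x' = frame_x z x y" and "y' = frame_y z x y"
  define L L' R R' where LR: "L = leftmost x V q" "L' = leftmost x' V q"
    "R = rightmost x V q" "R' = rightmost x' V q"
  note inj' = inj(2)[folded x'_def]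
  have sub: "L \<subseteq> V" "L' \<subseteq> V" "R \<subseteq> V" "R' \<subseteq> V" by (simp_all add: LR leftmost_subset)
  have fin: "finite L" "finite L'" "finite R" "finite R'" using sub V by (auto intro: finite_subset)
  have q: "q \<le> card V" using n ab by simp
  have card: "card L = q" "card L' = q" "card R = q" "card R' = q"
    using card_leftmost[OF V inj(1) q] card_leftmost[OF V inj' q]
      card_rightmost[OF V inj(1) q] card_rightmost[OF V inj' q] by (auto simp: LR)
  have flip: "card (B - A) = card (A - B)" if "card A = q" "card B = q" "finite A" "finite B" for A B :: "'a set"
    using card_Diff_subset_Int[of A B] card_Diff_subset_Int[of B A] that by (simp add: Int_commute)
  have d: "card (L - L') \<le> 1" "card (R - R') \<le> 1" using diff by (auto simp: LR x'_def)
  then have d': "card (L' - L) \<le> 1" "card (R' - R) \<le> 1"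
    using flip[OF card(1,2) fin(1,2)] flip[OF card(3,4) fin(3,4)] by auto
  obtain \<beta> where \<beta>: "graph_line \<beta>" "2 * a \<le> card {v\<in>L. \<beta> (x v) \<le> y v}" "2 * a \<le> card {v\<in>R. \<beta> (x v) \<le> y v}"
    "card {v\<in>V - L - R. \<beta> (x v) \<le> y v} < b"
    using low unfolding low_middle_def LR by blast
  obtain \<beta>'' where \<beta>'': "graph_line \<beta>''" "2 * a \<le> card {v\<in>R'. \<beta>'' (- x' v) \<le> - y' v}"
    "2 * a \<le> card {v\<in>L'. \<beta>'' (- x' v) \<le> - y' v}" "card {v\<in>V - R' - L'. \<beta>'' (- x' v) \<le> - y' v} < b"
    using high unfolding low_middle_def LR x'_def y'_def minus_minus by blast
  \<comment> \<open>The line for \<open>high\<close> lives in the negated coordinates; rotated back, it is \<open>f\<close>, and the points on or above it are now on or below \<open>f\<close>.\<close>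
  define f where "f = (\<lambda>t. - \<beta>'' (- t))"
  have fl: "graph_line f" unfolding f_def by (intro graph_line_uminus graph_line_reflect \<beta>'')
  have "\<beta>'' (- x' v) \<le> - y' v \<longleftrightarrow> y' v \<le> f (x' v)" for v by (auto simp: f_def)
  then have f: "2 * a \<le> card {v\<in>R'. y' v \<le> f (x' v)}" "2 * a \<le> card {v\<in>L'. y' v \<le> f (x' v)}"
    "card {v\<in>V - R' - L'. y' v \<le> f (x' v)} < b"
    using \<beta>'' by simp_all
  have common: "2 * a - 1 \<le> card {v\<in>A \<inter> B. P v}"
    if "2 * a \<le> card {v\<in>A. P v}" "card (A - B) \<le> 1" "finite A" for A B :: "'a set" and P
  proof -
    have "card {v\<in>A. P v} \<le> card ({v\<in>A \<inter> B. P v} \<union> (A - B))" using that by (intro card_mono) auto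
    also have "\<dots> \<le> card {v\<in>A \<inter> B. P v} + card (A - B)" by (rule card_Un_le)
    finally show ?thesis using that by simp
  qed
  define M where "M = (V - L - R) \<inter> (V - R' - L')"
  define W where "W = {v\<in>M. y v < \<beta> (x v) \<and> f (x' v) < y' v}"
  have cW: "6 * b - 4 \<le> card W"
  proof -
    have "card (A \<union> B) \<le> q + 1" if "card A = q" "card (B - A) \<le> 1" for A B :: "'a set"
      using card_Un_le[of A "B - A"] that by simp
    then have "card (L \<union> L') \<le> q + 1" "card (R \<union> R') \<le> q + 1" using card d' by auto
    then have "card ((L \<union> L') \<union> (R \<union> R')) \<le> (q + 1) + (q + 1)"
      using card_Un_le[of "L \<union> L'" "R \<union> R'"] by linarith
    moreover have "card V \<le> card (W \<union> ((L \<union> L') \<union> (R \<union> R')) \<union>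
        {v\<in>V - L - R. \<beta> (x v) \<le> y v} \<union> {v\<in>V - R' - L'. y' v \<le> f (x' v)})"
      using V fin by (intro card_mono) (auto simp: W_def M_def)
    moreover have "\<dots> \<le> card W + card ((L \<union> L') \<union> (R \<union> R')) +
        card {v\<in>V - L - R. \<beta> (x v) \<le> y v} + card {v\<in>V - R' - L'. y' v \<le> f (x' v)}"
      by (meson add_le_mono1 card_Un_le order_trans)
    ultimately show ?thesis using n ab \<beta>(4) f(3) by linarith
  qed
  have LM: "x l < x m" if "l \<in> L" "m \<in> M" for l m
    using leftmost_less[OF V] that by (auto simp: LR M_def)
  have MR: "x m < x r" if "m \<in> M" "r \<in> R" for m r
    using rightmost_less[OF V] that by (auto simp: LR M_def)
  have LM': "x' l < x' m" if "l \<in> L'" "m \<in> M" for l m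
    using leftmost_less[OF V] that by (auto simp: LR M_def)
  have MR': "x' m < x' r" if "m \<in> M" "r \<in> R'" for m r
    using rightmost_less[OF V] that by (auto simp: LR M_def)
  have low': "2 * a - 1 \<le> card {v\<in>L \<inter> L'. y' v \<le> f (x' v)}" "2 * a - 1 \<le> card {v\<in>R \<inter> R'. y' v \<le> f (x' v)}"
    using common[OF f(2) d'(1) fin(2)] common[OF f(1) d'(2) fin(4)] by (simp_all add: Int_commute)
  have high': "2 * a - 1 \<le> card {v\<in>L \<inter> L'. \<beta> (x v) \<le> y v}" "2 * a - 1 \<le> card {v\<in>R \<inter> R'. \<beta> (x v) \<le> y v}"
    using common[OF \<beta>(2) d(1) fin(1)] common[OF \<beta>(3) d(2) fin(3)] by simp_all
  have "0 < card {v\<in>L \<inter> L'. y' v \<le> f (x' v)}" "0 < card {v\<in>R \<inter> R'. y' v \<le> f (x' v)}" "0 < card W"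
    using low' cW ab by linarith+
  then have "{v\<in>L \<inter> L'. y' v \<le> f (x' v)} \<noteq> {}" "{v\<in>R \<inter> R'. y' v \<le> f (x' v)} \<noteq> {}" "W \<noteq> {}"
    unfolding card_gt_0_iff by blast+
  then obtain l r w where lrw: "l \<in> L \<inter> L'" "y' l \<le> f (x' l)" "r \<in> R \<inter> R'" "y' r \<le> f (x' r)" "w \<in> W"
    by blast
  obtain g where g: "graph_line g" "\<And>v. y' v \<le> f (x' v) \<longleftrightarrow> y v \<le> g (x v)"
    using graph_line_in_frame[OF z fl, of x l w r y] lrw LM MR LM' MR' unfolding x'_def y'_def
    by (auto simp: W_def x'_def y'_def)
  show ?thesis
  proof (rule arms_crossing_family[OF inj(1) gp V, where L = "L \<inter> L'" and R = "R \<inter> R'" and W = W and \<beta> = \<beta>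
        and \<beta>' = g and a = a and b = b])
    show "L \<inter> L' \<union> W \<union> R \<inter> R' \<subseteq> V" using sub by (auto simp: W_def M_def)
    show "g (x w) < y w" if "w \<in> W" for w using g(2)[of w] that by (auto simp: W_def)
    show "2 * a - 1 \<le> card {v\<in>L \<inter> L'. y v \<le> g (x v)}" "2 * a - 1 \<le> card {v\<in>R \<inter> R'. y v \<le> g (x v)}"
      using low' by (simp_all add: g(2))
  qed (use LM MR \<beta> g cW high' ab in \<open>auto simp: W_def\<close>)
qed

text \<open>The frames of \<open>z\<close> and \<open>w\<close> only have to agree with that of \<open>z0\<close> on the pairs which the latter orders strictly.
This holds for all \<open>z\<close> and \<open>w\<close> sufficiently close to \<open>z0\<close>, even if \<open>z0\<close> has ties.\<close>

lemma low_middle_adjacent_frames: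
  fixes x y :: "'a \<Rightarrow> real" and z0 z w :: complex
  assumes V: "finite V" and gp: "general_position x y V" and nz: "z0 \<noteq> 0" "z \<noteq> 0" "w \<noteq> 0"
    and inj: "inj_on (frame_x z x y) V" "inj_on (frame_x w x y) V"
    and cons: "\<And>u v. u \<in> V \<Longrightarrow> v \<in> V \<Longrightarrow> frame_x z0 x y u < frame_x z0 x y v \<Longrightarrow>
        frame_x z x y u < frame_x z x y v \<and> frame_x w x y u < frame_x w x y v"
    and n: "2 * q + 8 * b - 4 \<le> card V" and ab: "0 < a" "0 < b" "k \<le> a * b"
    and low: "low_middle (frame_x z x y) (frame_y z x y) V q (2 * a) b"
    and high: "low_middle (\<lambda>v. - frame_x w x y v) (\<lambda>v. - frame_y w x y v) V q (2 * a) b"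
  shows "crossing_family x y V k"
proof -
  have q: "q \<le> card V" using n ab by simp
  have ties: "\<not> (frame_x z0 x y u = frame_x z0 x y v \<and> frame_x z0 x y u = frame_x z0 x y v')"
    if "u \<in> V" "v \<in> V" "v' \<in> V" "u \<noteq> v" "u \<noteq> v'" "v \<noteq> v'" for u v v'
  proof -
    have "general_position (frame_x z0 x y) (frame_y z0 x y) V"
      using gp nz by (simp add: general_position_frame)
    from general_positionD[OF this that] show ?thesis by auto
  qed
  have w: "frame_x (w / z) (frame_x z x y) (frame_y z x y) = frame_x w x y"
    "frame_y (w / z) (frame_x z x y) (frame_y z x y) = frame_y w x y"
    using nz by (simp_all add: frame_mult)
  have "crossing_family (frame_x z x y) (frame_y z x y) V k"
  proof (rule low_and_high_middle_crossing_family[where z = "w / z" and a = a and b = b and q = q])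
    show "card (leftmost (frame_x z x y) V q - leftmost (frame_x (w / z) (frame_x z x y) (frame_y z x y)) V q) \<le> 1"
      unfolding w by (rule card_leftmost_diff_le_1[OF V inj q cons ties])
    show "card (rightmost (frame_x z x y) V q - rightmost (frame_x (w / z) (frame_x z x y) (frame_y z x y)) V q) \<le> 1"
      unfolding w
      by (rule card_leftmost_diff_le_1[OF V _ _ q, where ?x0.0 = "\<lambda>v. - frame_x z0 x y v"])
         (use inj cons ties in \<open>auto simp: inj_on_uminus\<close>)
  qed (use V gp nz inj n ab low high in \<open>auto simp: w general_position_frame\<close>)
  then show ?thesis using nz by (simp add: crossing_family_frame)
qed

lemma crossing_family_mono: "crossing_family x y V k \<Longrightarrow> j \<le> k \<Longrightarrow> crossing_family x y V j"
  unfolding crossing_family_def by (meson order_trans)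

section \<open>Turning by a half turn\<close>

text \<open>A path of directions from \<open>- 1\<close> to \<open>1\<close>.  It is polynomial, so that two distinct points have the same first coordinate
only at finitely many parameters.\<close>

definition half_turn :: "real \<Rightarrow> complex" where
  "half_turn t = Complex t (1 - t\<^sup>2)"

lemma half_turn_nonzero: "half_turn t \<noteq> 0"
  by (auto simp: half_turn_def complex_eq_iff)

lemma half_turn_1: "half_turn 1 = 1" and half_turn_minus_1: "half_turn (- 1) = - 1"
  by (auto simp: half_turn_def complex_eq_iff)

lemma finite_non_injective_half_turn:
  assumes V: "finite V" and dist: "inj_on (\<lambda>v. (x v, y v)) V"
  shows "finite {t. \<not> inj_on (frame_x (half_turn t) x y) V}"
proof (rule finite_subset)
  define p where "p u v = [:y u - y v, x u - x v, - (y u - y v):]" for u v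
  show "{t. \<not> inj_on (frame_x (half_turn t) x y) V} \<subseteq> (\<Union>u\<in>V. \<Union>v\<in>V - {u}. {t. poly (p u v) t = 0})"
  proof
    fix t assume "t \<in> {t. \<not> inj_on (frame_x (half_turn t) x y) V}"
    then obtain u v where uv: "u \<in> V" "v \<in> V" "u \<noteq> v" "frame_x (half_turn t) x y u = frame_x (half_turn t) x y v"
      by (auto simp: inj_on_def)
    then have "poly (p u v) t = 0"
      by (simp add: p_def frame_x_def half_turn_def algebra_simps power2_eq_square)
    with uv show "t \<in> (\<Union>u\<in>V. \<Union>v\<in>V - {u}. {t. poly (p u v) t = 0})" by blast
  qed
  show "finite (\<Union>u\<in>V. \<Union>v\<in>V - {u}. {t. poly (p u v) t = 0})"
  proof (intro finite_UN_I V finite_Diff)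
    fix u v assume "u \<in> V" "v \<in> V - {u}"
    then have "p u v \<noteq> 0" using inj_onD[OF dist, of u v] by (auto simp: p_def)
    then show "finite {t. poly (p u v) t = 0}" by (rule poly_roots_finite)
  qed
qed

lemma frame_order_locally_stable:
  assumes V: "finite V"
  shows "\<exists>T. open T \<and> t0 \<in> T \<and> (\<forall>t\<in>T. \<forall>u\<in>V. \<forall>v\<in>V.
    frame_x (half_turn t0) x y u < frame_x (half_turn t0) x y v \<longrightarrow>
    frame_x (half_turn t) x y u < frame_x (half_turn t) x y v)"
proof -
  have "\<forall>\<^sub>F t in nhds t0. frame_x (half_turn t0) x y u < frame_x (half_turn t0) x y v \<longrightarrow>
      frame_x (half_turn t) x y u < frame_x (half_turn t) x y v" for u v
  proof (cases "frame_x (half_turn t0) x y u < frame_x (half_turn t0) x y v")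
    case True
    have "((\<lambda>t. frame_x (half_turn t) x y v - frame_x (half_turn t) x y u) \<longlongrightarrow>
        frame_x (half_turn t0) x y v - frame_x (half_turn t0) x y u) (nhds t0)"
      unfolding frame_x_def half_turn_def complex.sel by (intro tendsto_intros filterlim_ident)
    then have "\<forall>\<^sub>F t in nhds t0. 0 < frame_x (half_turn t) x y v - frame_x (half_turn t) x y u"
      by (rule order_tendstoD(1)) (use True in simp)
    then show ?thesis by (rule eventually_mono) simp
  qed simp
  then have "\<forall>\<^sub>F t in nhds t0. \<forall>u\<in>V. \<forall>v\<in>V. frame_x (half_turn t0) x y u < frame_x (half_turn t0) x y v \<longrightarrow>
      frame_x (half_turn t) x y u < frame_x (half_turn t) x y v"
    using V by (intro eventually_ball_finite ballI)
  then show ?thesis unfolding eventually_nhds by blast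
qed

text \<open>At each parameter where the first coordinates are distinct, the middle is low or high.  If there is no
crossing family, low and high exclude each other locally, so being low is locally constant and therefore constant along the whole path.
But the two ends of the path are opposite directions, for which low and high are exchanged.\<close>

lemma crossing_family_distinct_x:
  fixes x y :: "'a \<Rightarrow> real"
  assumes V: "finite V" and gp: "general_position x y V" and inj: "inj_on x V"
    and n: "8 * a + 10 * b - 8 \<le> card V" and ab: "0 < a" "0 < b" "k \<le> a * b" "k \<le> b * b"
  shows "crossing_family x y V k"
proof (rule ccontr)
  assume no: "\<not> crossing_family x y V k"
  define q where "q = 4 * a + b - 2"
  have q: "2 * q + 8 * b - 4 \<le> card V" "2 * q \<le> card V" using n ab by (auto simp: q_def)
  define X Y where "X t = frame_x (half_turn t) x y" and "Y t = frame_y (half_turn t) x y" for t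
  define low where "low t \<longleftrightarrow> low_middle (X t) (Y t) V q (2 * a) b" for t
  define high where "high t \<longleftrightarrow> low_middle (\<lambda>v. - X t v) (\<lambda>v. - Y t v) V q (2 * a) b" for t
  have XY1: "X 1 = x" "Y 1 = y" "X (- 1) = (\<lambda>v. - x v)" "Y (- 1) = (\<lambda>v. - y v)"
    by (simp_all add: X_def Y_def half_turn_1 half_turn_minus_1 frame_1 frame_uminus)
  have inj1: "inj_on (X 1) V" "inj_on (X (- 1)) V" using inj by (simp_all add: XY1 inj_on_uminus)
  have low_high: "low t \<or> high t" if "inj_on (X t) V" for t
  proof -
    have "\<not> crossing_family (X t) (Y t) V (b * b)"
      using no crossing_family_mono[OF _ ab(4)] by (auto simp: X_def Y_def crossing_family_frame half_turn_nonzero)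
    then show ?thesis
      using crossing_family_or_low_middle[OF V that _ ab(1,2) q_def q(2), of "Y t"] gp
      by (auto simp: low_def high_def X_def Y_def general_position_frame half_turn_nonzero)
  qed
  have adjacent: "\<not> (low t \<and> high s)"
    if "inj_on (X t) V" "inj_on (X s) V"
      "\<And>u v. u \<in> V \<Longrightarrow> v \<in> V \<Longrightarrow> X r u < X r v \<Longrightarrow> X t u < X t v \<and> X s u < X s v" for r s t
    using low_middle_adjacent_frames[OF V gp half_turn_nonzero[of r] half_turn_nonzero[of t] half_turn_nonzero[of s]
        that[unfolded X_def] q(1) ab(1-3)] no
    by (auto simp: low_def high_def X_def Y_def)
  have step: "\<exists>T. openin (top_of_set UNIV) T \<and> r \<in> T \<and>
      (\<forall>t\<in>T. \<forall>s\<in>T. inj_on (X t) V \<and> inj_on (X s) V \<and> low t \<longrightarrow> low s)" for r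
  proof -
    obtain T where T: "open T" "r \<in> T"
      "\<And>t u v. t \<in> T \<Longrightarrow> u \<in> V \<Longrightarrow> v \<in> V \<Longrightarrow> X r u < X r v \<Longrightarrow> X t u < X t v"
      using frame_order_locally_stable[OF V, of r x y] unfolding X_def by blast
    have "low s" if "t \<in> T" "s \<in> T" "inj_on (X t) V" "inj_on (X s) V" "low t" for t s
      using adjacent[of t s r] low_high[of s] that T(3) by blast
    then show ?thesis using T(1,2) by (intro exI[of _ T]) auto
  qed
  have dense: "\<exists>t. t \<in> T \<and> inj_on (X t) V" if "openin (top_of_set UNIV) T" "r \<in> T" for T r
  proof (rule ccontr)
    assume "\<not> ?thesis"
    then have "T \<subseteq> {t. \<not> inj_on (frame_x (half_turn t) x y) V}" by (auto simp: X_def)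
    moreover have "inj_on (\<lambda>v. (x v, y v)) V" using inj by (auto simp: inj_on_def)
    ultimately have "finite T" using finite_non_injective_half_turn[OF V] finite_subset by blast
    then show False using that finite_imp_not_open[of T] by auto
  qed
  have spread: "low s" if "inj_on (X t) V" "inj_on (X s) V" "low t" for t s
    by (rule connected_induction[OF connected_UNIV dense step UNIV_I UNIV_I that(1,2,3)])
  have reverse: "high 1 \<longleftrightarrow> low (- 1)" "high (- 1) \<longleftrightarrow> low 1"
    by (simp_all add: low_def high_def XY1)
  have "low 1 \<and> high 1"
    using low_high[OF inj1(1)] low_high[OF inj1(2)] spread[OF inj1] spread[OF inj1(2,1)] reverse by blast
  then show False using adjacent[of 1 1 1] inj1 by blast
qed

lemma general_position_crossing_family:
  fixes x y :: "'a \<Rightarrow> real"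
  assumes V: "finite V" and gp: "general_position x y V" and dist: "inj_on (\<lambda>v. (x v, y v)) V"
    and n: "8 * a + 10 * b - 8 \<le> card V" and ab: "0 < a" "0 < b" "k \<le> a * b" "k \<le> b * b"
  shows "crossing_family x y V k"
proof -
  obtain t where t: "inj_on (frame_x (half_turn t) x y) V"
    using finite_non_injective_half_turn[OF V dist] ex_new_if_finite[OF infinite_UNIV_char_0] by blast
  have "crossing_family (frame_x (half_turn t) x y) (frame_y (half_turn t) x y) V k"
    by (rule crossing_family_distinct_x[OF V _ t n ab]) (simp add: general_position_frame half_turn_nonzero gp)
  then show ?thesis by (simp add: crossing_family_frame half_turn_nonzero)
qed

section \<open>From crossing families to colorings\<close>

text \<open>Take \<open>b = \<lceil>\<surd>k\<rceil>\<close>, and for \<open>a\<close> either \<open>b - 1\<close> or \<open>b\<close>.  Allowing \<open>a = b - 1\<close> keeps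
\<open>8 a + 10 b - 8\<close> below \<open>20 \<surd>k\<close> also when \<open>k\<close> is only slightly larger than a square.\<close>

lemma ex_arm_sizes:
  fixes k n :: nat
  assumes k: "0 < k" and n: "400 * k \<le> n\<^sup>2"
  shows "\<exists>a b. 0 < a \<and> 0 < b \<and> k \<le> a * b \<and> k \<le> b * b \<and> 8 * a + 10 * b - 8 \<le> n"
proof -
  define b where "b = (LEAST b. k \<le> b * b)"
  have b: "k \<le> b * b" unfolding b_def by (rule LeastI[of _ k]) simp
  then obtain c where c: "b = Suc c" using k by (cases b) auto
  have "\<not> k \<le> c * c" using not_less_Least[of c "\<lambda>b. k \<le> b * b"] c by (simp add: b_def)
  then have kc: "c * c + 1 \<le> k" by simp
  show ?thesis
  proof (cases "k \<le> c * b")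
    case True
    have "8 * c + 10 * b - 8 \<le> n"
    proof (rule ccontr)
      assume "\<not> ?thesis"
      then have "n \<le> 18 * c + 1" using c by simp
      then have "n\<^sup>2 \<le> (18 * c + 1)\<^sup>2" by (rule power_mono) simp
      also have "\<dots> < 400 * (c * c + 1)"
      proof -
        have "36 * c \<le> 36 * (c * c) + 36" by (cases c) auto
        then show ?thesis by (simp add: power2_eq_square algebra_simps)
      qed
      also have "\<dots> \<le> 400 * k" using kc by simp
      finally show False using n by simp
    qed
    moreover have "0 < c" using True k by (cases c) auto
    ultimately show ?thesis using True b c by (intro exI[of _ c] exI[of _ b]) auto
  next
    case False
    have "8 * b + 10 * b - 8 \<le> n"
    proof (rule ccontr)
      assume "\<not> ?thesis"
      then have "n \<le> 18 * c + 9" using c by simp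
      then have "n\<^sup>2 \<le> (18 * c + 9)\<^sup>2" by (rule power_mono) simp
      also have "\<dots> < 400 * (c * b + 1)"
        using c by (simp add: power2_eq_square algebra_simps)
      also have "\<dots> \<le> 400 * k" using False by simp
      finally show False using n by simp
    qed
    then show ?thesis using b c by (intro exI[of _ b] exI[of _ b]) auto
  qed
qed

lemma collinear_if_turn_zero:
  fixes P Q R :: "real^2"
  assumes "(Q $ 1 - P $ 1) * (R $ 2 - P $ 2) = (R $ 1 - P $ 1) * (Q $ 2 - P $ 2)"
  shows "collinear {P, Q, R}"
proof (cases "Q = P")
  case False
  define d where "d = Q - P"
  define e where "e = R - P"
  have eq: "d $ 1 * e $ 2 = e $ 1 * d $ 2" using assms by (simp add: d_def e_def)
  have "d \<noteq> 0" using False by (simp add: d_def)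
  then have "d $ 1 \<noteq> 0 \<or> d $ 2 \<noteq> 0" by (auto simp: vec_eq_iff forall_2)
  then have "\<exists>c. e = c *\<^sub>R d"
  proof
    assume "d $ 1 \<noteq> 0"
    then show ?thesis using eq
      by (intro exI[of _ "e $ 1 / d $ 1"]) (auto simp: vec_eq_iff forall_2 field_simps)
  next
    assume "d $ 2 \<noteq> 0"
    then show ?thesis using eq
      by (intro exI[of _ "e $ 2 / d $ 2"]) (auto simp: vec_eq_iff forall_2 field_simps)
  qed
  then have "collinear {0, d, e}" by (auto simp: collinear_lemma)
  then have "collinear {Q, P, R}" by (simp add: collinear_3[of Q P R] d_def e_def)
  then show ?thesis by (simp add: insert_commute)
qed simp

lemma geometric_graph_general_position:
  assumes "geometric_graph (complete_graph V) p"
  shows "general_position (\<lambda>v. p v $ 1) (\<lambda>v. p v $ 2) V" "inj_on p V"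
    "inj_on (\<lambda>v. (p v $ 1, p v $ 2)) V"
proof -
  show "general_position (\<lambda>v. p v $ 1) (\<lambda>v. p v $ 2) V" "inj_on p V"
    using assms collinear_if_turn_zero
    unfolding geometric_graph_def general_position_def complete_graph_def by auto blast
  then show "inj_on (\<lambda>v. (p v $ 1, p v $ 2)) V"
    by (auto simp: inj_on_def vec_eq_iff forall_2)
qed

lemma crosses_open_segments:
  fixes p :: "'a \<Rightarrow> real^2"
  assumes cr: "crosses (\<lambda>v. p v $ 1) (\<lambda>v. p v $ 2) a c b d" and ne: "p a \<noteq> p c" "p b \<noteq> p d"
  shows "open_segment (p a) (p c) \<inter> open_segment (p b) (p d) \<noteq> {}"
proof -
  obtain \<alpha> \<beta> where 1: "0 < \<alpha>" "\<alpha> < 1" "0 < \<beta>" "\<beta> < 1"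
    "(1 - \<alpha>) * p a $ 1 + \<alpha> * p c $ 1 = (1 - \<beta>) * p b $ 1 + \<beta> * p d $ 1"
    "(1 - \<alpha>) * p a $ 2 + \<alpha> * p c $ 2 = (1 - \<beta>) * p b $ 2 + \<beta> * p d $ 2"
    using cr by (auto simp: crosses_def)
  define s where "s = (1 - \<alpha>) *\<^sub>R p a + \<alpha> *\<^sub>R p c"
  have "s = (1 - \<beta>) *\<^sub>R p b + \<beta> *\<^sub>R p d" using 1 by (simp add: s_def vec_eq_iff forall_2)
  then have "s \<in> open_segment (p a) (p c)" "s \<in> open_segment (p b) (p d)"
    using 1 ne by (auto simp: in_segment s_def)
  then show ?thesis by blast
qed

text \<open>Color \<open>i\<close> is given to the \<open>i\<close>-th edge of \<open>E\<close> and the \<open>i\<close>-th edge of \<open>F\<close>.  All other edges get color 1: only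
edges of larger color than some \<open>i\<close> are subject to a condition.\<close>

lemma crossing_edge_sets_coloring:
  assumes E: "finite E" "E \<subseteq> edges G" "k \<le> card E" and F: "finite F" "F \<subseteq> edges G" "k \<le> card F"
    and disj: "E \<inter> F = {}" and k: "0 < k"
    and adj: "\<And>e f. e \<in> E \<Longrightarrow> f \<in> F \<Longrightarrow> adj p e f \<and> adj p f e"
  shows "\<exists>c. pseudo_Grundy_coloring adj G p k c"
proof -
  obtain e where e: "e ` {1..k} \<subseteq> E" "inj_on e {1..k}"
    using card_le_inj[of "{1..k}" E] E by auto
  obtain f where f: "f ` {1..k} \<subseteq> F" "inj_on f {1..k}"
    using card_le_inj[of "{1..k}" F] F by auto
  define c where "c s = (if s \<in> e ` {1..k} then inv_into {1..k} e s
    else if s \<in> f ` {1..k} then inv_into {1..k} f s else 1)" for s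
  have ce: "c (e i) = i" if "i \<in> {1..k}" for i using that e by (simp add: c_def)
  have cf: "c (f i) = i" if "i \<in> {1..k}" for i
  proof -
    have "f i \<notin> e ` {1..k}" using that e f disj by blast
    then show ?thesis using that f by (simp add: c_def)
  qed
  have range: "c s \<in> {1..k}" for s
    using k inv_into_into[of s e "{1..k}"] inv_into_into[of s f "{1..k}"] by (auto simp: c_def)
  have "c ` edges G = {1..k}"
  proof
    show "{1..k} \<subseteq> c ` edges G" using ce e E by (metis image_eqI image_subset_iff subsetD subsetI)
  qed (use range in blast)
  moreover have "\<exists>t\<in>edges G. c t = i \<and> adj p s t"
    if i: "i \<in> {1..k}" "i < j" and s: "c s = j" for i j s
  proof -
    have "s \<in> e ` {1..k} \<or> s \<in> f ` {1..k}" using i s by (auto simp: c_def split: if_splits)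
    then show ?thesis
    proof
      assume "s \<in> e ` {1..k}"
      then show ?thesis using adj cf[OF i(1)] i(1) e f F by (intro bexI[of _ "f i"]) blast+
    next
      assume "s \<in> f ` {1..k}"
      then show ?thesis using adj ce[OF i(1)] i(1) e f E by (intro bexI[of _ "e i"]) blast+
    qed
  qed
  ultimately have "pseudo_Grundy_coloring adj G p k c"
    unfolding pseudo_Grundy_coloring_def by blast
  then show ?thesis by blast
qed

lemma card_edges_between:
  assumes "finite A" "finite C" "A \<inter> C = {}"
  shows "card ((\<lambda>(a, c). {a, c}) ` (A \<times> C)) = card A * card C"
proof -
  have "inj_on (\<lambda>(a, c). {a, c}) (A \<times> C)"
    using assms(3) by (auto simp: inj_on_def doubleton_eq_iff)
  then show ?thesis by (simp add: card_image card_cartesian_product)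
qed

lemma edges_between_subset:
  assumes "A \<subseteq> V" "C \<subseteq> V" "A \<inter> C = {}"
  shows "(\<lambda>(a, c). {a, c}) ` (A \<times> C) \<subseteq> edges (complete_graph V)"
  using assms by (auto simp: complete_graph_def nsets_def card_insert_if disjoint_iff)

lemma crossing_family_coloring:
  assumes V: "finite V" and G: "geometric_graph (complete_graph V) p" and k: "0 < k"
    and fam: "crossing_family (\<lambda>v. p v $ 1) (\<lambda>v. p v $ 2) V k"
  shows "\<exists>c. pseudo_Grundy_coloring segment_crossing (complete_graph V) p k c"
proof -
  obtain A B C D where sub: "A \<subseteq> V" "B \<subseteq> V" "C \<subseteq> V" "D \<subseteq> V"
    and disj: "(A \<union> C) \<inter> (B \<union> D) = {}" "A \<inter> C = {}" "B \<inter> D = {}"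
    and card: "k \<le> card A * card C" "k \<le> card B * card D"
    and cross: "\<forall>a\<in>A. \<forall>c\<in>C. \<forall>b\<in>B. \<forall>d\<in>D. crosses (\<lambda>v. p v $ 1) (\<lambda>v. p v $ 2) a c b d"
    using fam unfolding crossing_family_def by (elim exE conjE) auto
  have fin: "finite A" "finite B" "finite C" "finite D" using sub V by (auto intro: finite_subset)
  define E F where "E = (\<lambda>(a, c). {a, c}) ` (A \<times> C)" and "F = (\<lambda>(b, d). {b, d}) ` (B \<times> D)"
  show ?thesis
  proof (rule crossing_edge_sets_coloring[where E = E and F = F])
    show "finite E" "finite F" using fin by (auto simp: E_def F_def)
    show "E \<subseteq> edges (complete_graph V)" "F \<subseteq> edges (complete_graph V)"
      unfolding E_def F_def
      using edges_between_subset[OF sub(1,3) disj(2)] edges_between_subset[OF sub(2,4) disj(3)] by simp_all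
    show "k \<le> card E" "k \<le> card F"
      unfolding E_def F_def using card fin disj by (simp_all add: card_edges_between)
    show "E \<inter> F = {}" using disj by (auto simp: E_def F_def doubleton_eq_iff)
    show "segment_crossing p e f \<and> segment_crossing p f e" if ef: "e \<in> E" "f \<in> F" for e f
    proof -
      obtain a c b d where abcd: "a \<in> A" "c \<in> C" "b \<in> B" "d \<in> D" and e: "e = {a, c}" and f: "f = {b, d}"
        using ef by (auto simp: E_def F_def)
      have "a \<noteq> c" "b \<noteq> d" "e \<noteq> f" using abcd disj e f by (auto simp: doubleton_eq_iff)
      moreover have "p a \<noteq> p c" "p b \<noteq> p d"
        using inj_onD[OF geometric_graph_general_position(2)[OF G]] calculation(1,2) abcd sub by blast+
      then have "open_segment (p a) (p c) \<inter> open_segment (p b) (p d) \<noteq> {}"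
        using cross abcd by (intro crosses_open_segments) auto
      ultimately show ?thesis unfolding segment_crossing_def e f by (metis inf_commute)
    qed
  qed (rule k)
qed

lemma le_pseudo_Grundy_index:
  assumes "finite (edges G)" "pseudo_Grundy_coloring adj G p k c"
  shows "k \<le> pseudo_Grundy_index adj G p"
  unfolding pseudo_Grundy_index_def
  using finite_pseudo_Grundy_coloring_sizes[OF assms(1)] assms(2) by (intro Max_ge) auto

lemma pseudo_Grundy_coloring_mono:
  assumes "pseudo_Grundy_coloring adj G p k c" "\<And>e f. adj p e f \<Longrightarrow> adj' p e f"
  shows "pseudo_Grundy_coloring adj' G p k c"
  using assms unfolding pseudo_Grundy_coloring_def by blast

theorem theorem6:
  fixes V :: "'a set" and n :: nat
  assumes "finite V" and "card V = n"
  shows "\<lfloor>real n ^ 2 / 400\<rfloor>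
           \<le> int (geometric_pseudo_Grundy_index segment_crossing (complete_graph V))
       \<and> \<lfloor>real n ^ 2 / 400\<rfloor>
           \<le> int (geometric_pseudo_Grundy_index segment_intersection (complete_graph V))"
proof -
  define k where "k = nat \<lfloor>real n ^ 2 / 400\<rfloor>"
  have k: "\<lfloor>real n ^ 2 / 400\<rfloor> = int k" by (simp add: k_def)
  have "real k \<le> real n ^ 2 / 400" using of_int_floor_le[of "real n ^ 2 / 400"] k by simp
  then have "real (400 * k) \<le> real (n\<^sup>2)" by simp
  then have kn: "400 * k \<le> n\<^sup>2" by (simp only: of_nat_le_iff)
  have fin: "finite (edges (complete_graph V))" "finite (verts (complete_graph V))"
    using assms(1) by (auto simp: complete_graph_def finite_imp_finite_nsets)
  have coloring: "\<exists>c. pseudo_Grundy_coloring segment_crossing (complete_graph V) p k c"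
    if G: "geometric_graph (complete_graph V) p" and "0 < k" for p
  proof -
    obtain a b where ab: "0 < a" "0 < b" "k \<le> a * b" "k \<le> b * b" "8 * a + 10 * b - 8 \<le> n"
      using ex_arm_sizes[OF \<open>0 < k\<close> kn] by blast
    have "crossing_family (\<lambda>v. p v $ 1) (\<lambda>v. p v $ 2) V k"
      using general_position_crossing_family[OF assms(1) geometric_graph_general_position(1,3)[OF G] _ ab(1-4)]
        ab(5) assms(2) by simp
    then show ?thesis using crossing_family_coloring[OF assms(1) G \<open>0 < k\<close>] by blast
  qed
  have index: "k \<le> geometric_pseudo_Grundy_index adj (complete_graph V)"
    if adj: "\<And>p e f. segment_crossing p e f \<Longrightarrow> adj p e f" for adj :: "'a criterion"
    unfolding geometric_pseudo_Grundy_index_def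
  proof (rule cInf_greatest)
    show "{pseudo_Grundy_index adj (complete_graph V) p |p. geometric_graph (complete_graph V) p} \<noteq> {}"
      using ex_geometric_graph[OF fin(2)] by blast
    fix m assume "m \<in> {pseudo_Grundy_index adj (complete_graph V) p |p. geometric_graph (complete_graph V) p}"
    then obtain p where p: "m = pseudo_Grundy_index adj (complete_graph V) p" "geometric_graph (complete_graph V) p"
      by blast
    show "k \<le> m"
    proof (cases "k = 0")
      case False
      then obtain c where "pseudo_Grundy_coloring segment_crossing (complete_graph V) p k c"
        using coloring[OF p(2)] by auto
      then have "pseudo_Grundy_coloring adj (complete_graph V) p k c"
        using adj by (rule pseudo_Grundy_coloring_mono)
      then show ?thesis unfolding p(1) by (rule le_pseudo_Grundy_index[OF fin(1)])
    qed simp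
  qed
  have "k \<le> geometric_pseudo_Grundy_index segment_crossing (complete_graph V)"
    by (rule index)
  moreover have "k \<le> geometric_pseudo_Grundy_index segment_intersection (complete_graph V)"
    by (rule index) (auto simp: segment_intersection_def segment_crossing_def)
  ultimately show ?thesis unfolding k by simp
qed

end
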